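(* For $K\ge2$, let $\rho_K$ and $\tau_K$ be respectively Spearman's rho and Kendall's tau of the bivariate copula of the first and the $K$-th marginals of the $K$-extremal copula. Then both sequences $(\rho_K)_{K\ge2}$ and $(\tau_K)_{K\ge2}$ converge to zero as $K\to\infty$.
   Context: For a bivariate copula $C$, Spearman's rho is $$12\int_0^1\int_0^1 C(u,v)\,du\,dv-3=12\int_0^1\int_0^1 uv\,dC(u,v)-3$$ and Kendall's tau is $$4\int_0^1\int_0^1 C(u,v)\,dC(u,v)-1.$$ For parameters $\mu\in\mathbb{R}$, $\sigma>0$, $\xi\in\mathbb{R}$ define $$\Lambda(z)=\Big[1+\xi\,\tfrac{z-\mu}{\sigma}\Big]^{-1/\xi}\ \text{ if }\xi\ne 0 \text{ and } \xi\,\tfrac{z-\mu}{\sigma}>-1,\qquad \Lambda(z)=\exp\big(-\tfrac{z-\mu}{\sigma}\big)\ \text{ if }\xi=0,\ z\in\mathbb{R}.$$ The $K$-dimensional Multivariate Generalized Extreme Value (MGEV) distribution with parameters $(\mu,\sigma,\xi)$ is the probability distribution on $\mathbb{R}^K$ with density $$\tilde g_K(z_1,\dots,z_K)=(-1)^K\exp\{-\Lambda(z_K)\}\prod_{j=1}^K\Lambda'(z_j)\ \text{ if }(z_1,\dots,z_K)\in\Omega_\xi,$$ and $\tilde g_K=0$ otherwise, where $\Omega_0=\{z_1>\dots>z_K\}$, $\Omega_\xi=\{z_1>\dots>z_K>\mu-\frac{\sigma}{\xi}\}$ for $\xi>0$, and $\Omega_\xi=\{\mu-\frac{\sigma}{\xi}>z_1>\dots>z_K\}$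 for $\xi<0$. The $K$-extremal copula $C_K$ is the copula of the $K$-dimensional MGEV distribution, which does not depend on $(\mu,\sigma,\xi)$. The bivariate copula of its first and $K$-th marginals is $C(u,v)=C_K(u,1,\dots,1,v)$. *)

theory Defs
  imports "HOL-Probability.Probability"
begin

text \<open>
  The index set of a \<open>K\<close>-dimensional vector is \<open>{1..K}\<close>; points of \<open>K\<close>-dimensional space are the
  elements of \<open>{1..K} \<rightarrow>\<^sub>E UNIV\<close>, the space of \<open>PiM {1..K} (\<lambda>_. borel)\<close>.
\<close>

subsection \<open>Copulas\<close>

text \<open>
  A copula is a distribution function on the unit cube with uniform margins. Only its values on
  \<open>{1..K} \<rightarrow>\<^sub>E {0..1}\<close> are constrained.
\<close>
definition is_copula :: "nat \<Rightarrow> ((nat \<Rightarrow> real) \<Rightarrow> real) \<Rightarrow> bool" where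
  "is_copula K C \<longleftrightarrow>
     (\<exists>P. prob_space P \<and> sets P = sets (PiM {1..K} (\<lambda>_. borel :: real measure)) \<and>
          (\<forall>i\<in>{1..K}. distr P borel (\<lambda>x. x i) = uniform_measure lborel {0..1}) \<and>
          (\<forall>u\<in>{1..K} \<rightarrow>\<^sub>E {0..1}. C u = measure P {x \<in> space P. \<forall>i\<in>{1..K}. x i \<le> u i}))"

text \<open>
  \<open>C\<close> is a copula of the distribution \<open>M\<close> if Sklar's identity
  \<open>F(x\<^sub>1,\<dots>,x\<^sub>K) = C(F\<^sub>1(x\<^sub>1),\<dots>,F\<^sub>K(x\<^sub>K))\<close> holds. If the margins of \<open>M\<close> are continuous, this determines
  \<open>C\<close> uniquely on the unit cube.
\<close>
definition is_copula_of :: "nat \<Rightarrow> ((nat \<Rightarrow> real) \<Rightarrow> real) \<Rightarrow> (nat \<Rightarrow> real) measure \<Rightarrow> bool" where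
  "is_copula_of K C M \<longleftrightarrow>
     is_copula K C \<and>
     (\<forall>x\<in>{1..K} \<rightarrow>\<^sub>E UNIV.
        measure M {y \<in> space M. \<forall>i\<in>{1..K}. y i \<le> x i} =
        C (\<lambda>i\<in>{1..K}. cdf (distr M borel (\<lambda>y. y i)) (x i)))"

definition first_last_margin :: "nat \<Rightarrow> ((nat \<Rightarrow> real) \<Rightarrow> real) \<Rightarrow> real \<Rightarrow> real \<Rightarrow> real" where
  "first_last_margin K C u v = C (\<lambda>i\<in>{1..K}. if i = 1 then u else if i = K then v else 1)"

subsection \<open>Measures of association of a bivariate copula\<close>

text \<open>
  The measure \<open>dC\<close>. For a copula, \<open>C 1 1 = 1\<close>, \<open>C u 0 = 0\<close> and \<open>C 0 v = 0\<close>, so the conditions force the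
  measure to be concentrated on the unit square and determine it uniquely.
\<close>
definition copula_measure :: "(real \<Rightarrow> real \<Rightarrow> real) \<Rightarrow> (real \<times> real) measure" where
  "copula_measure C =
     (THE P. prob_space P \<and> sets P = sets borel \<and>
        (\<forall>u\<in>{0..1}. \<forall>v\<in>{0..1}. measure P ({..u} \<times> {..v}) = C u v))"

definition spearman_rho :: "(real \<Rightarrow> real \<Rightarrow> real) \<Rightarrow> real" where
  "spearman_rho C = 12 * (LBINT v:{0..1}. (LBINT u:{0..1}. C u v)) - 3"

definition kendall_tau :: "(real \<Rightarrow> real \<Rightarrow> real) \<Rightarrow> real" where
  "kendall_tau C =
     4 * (LINT p:{0..1} \<times> {0..1}|copula_measure C. C (fst p) (snd p)) - 1"

subsection \<open>The multivariate generalized extreme value distribution\<close>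

text \<open>
  For \<open>\<xi> \<noteq> 0\<close> the value \<open>0\<close> outside the domain of \<open>\<Lambda>\<close> is arbitrary: the domain is open and the
  coordinates of every point of \<open>mgev_domain\<close> lie in it.
\<close>
definition mgev_Lambda :: "real \<Rightarrow> real \<Rightarrow> real \<Rightarrow> real \<Rightarrow> real" where
  "mgev_Lambda \<mu> \<sigma> \<xi> z =
     (if \<xi> = 0 then exp (- ((z - \<mu>) / \<sigma>))
      else if \<xi> * ((z - \<mu>) / \<sigma>) > -1 then (1 + \<xi> * ((z - \<mu>) / \<sigma>)) powr (- 1 / \<xi>)
      else 0)"

definition mgev_domain :: "nat \<Rightarrow> real \<Rightarrow> real \<Rightarrow> real \<Rightarrow> (nat \<Rightarrow> real) set" where
  "mgev_domain K \<mu> \<sigma> \<xi> =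
     {z \<in> {1..K} \<rightarrow>\<^sub>E UNIV.
        (\<forall>i\<in>{1..K}. \<forall>j\<in>{1..K}. i < j \<longrightarrow> z i > z j) \<and>
        (\<xi> > 0 \<longrightarrow> z K > \<mu> - \<sigma> / \<xi>) \<and>
        (\<xi> < 0 \<longrightarrow> \<mu> - \<sigma> / \<xi> > z 1)}"

definition mgev_density :: "nat \<Rightarrow> real \<Rightarrow> real \<Rightarrow> real \<Rightarrow> (nat \<Rightarrow> real) \<Rightarrow> real" where
  "mgev_density K \<mu> \<sigma> \<xi> z =
     (if z \<in> mgev_domain K \<mu> \<sigma> \<xi>
      then (-1) ^ K * exp (- mgev_Lambda \<mu> \<sigma> \<xi> (z K)) * (\<Prod>j=1..K. deriv (mgev_Lambda \<mu> \<sigma> \<xi>) (z j))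
      else 0)"

definition mgev :: "nat \<Rightarrow> real \<Rightarrow> real \<Rightarrow> real \<Rightarrow> (nat \<Rightarrow> real) measure" where
  "mgev K \<mu> \<sigma> \<xi> = density (PiM {1..K} (\<lambda>_. lborel)) (\<lambda>z. ennreal (mgev_density K \<mu> \<sigma> \<xi> z))"

end

theory Submission
  imports Defs
begin

text \<open>
  The idea is that the first and the \<open>K\<close>-th coordinate are almost independent, uniformly over the unit
  square, and that both measures of association are continuous at the independence copula.

  The substitution \<open>t\<^sub>j = \<Lambda> (z\<^sub>j)\<close> turns the MGEV density into \<open>exp (- t\<^sub>K)\<close> on
  \<open>0 < t\<^sub>1 < \<dots> < t\<^sub>K\<close>, the joint density of the first \<open>K\<close> arrival times \<open>T\<^sub>1 < \<dots> < T\<^sub>K\<close> of a Poisson process of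
  rate \<open>1\<close>. As \<open>\<Lambda>\<close> is decreasing, the copula of the first and the last margin expresses the
  probability of \<open>T\<^sub>1 \<ge> r \<and> T\<^sub>K \<ge> s\<close> through those of \<open>T\<^sub>1 \<ge> r\<close> and \<open>T\<^sub>K \<ge> s\<close>. Iterated integration of
  the density, starting from the last coordinate, gives this joint tail in closed form (\<open>emeasure_mgev\<close>).

  By memorylessness the joint tail is \<open>exp (- r)\<close> times the tail of \<open>T\<^sub>K\<close> at \<open>s - r\<close>, whereas
  independence would give \<open>exp (- r)\<close> times the tail of \<open>T\<^sub>K\<close> at \<open>s\<close>. The density of \<open>T\<^sub>K\<close> spreads out as
  \<open>K\<close> grows: its maximum \<open>poisson_peak (K - 1)\<close> tends to \<open>0\<close>. Hence the copula differs from \<open>u * v\<close> by at most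
  \<open>poisson_peak (K - 1)\<close> (\<open>arrival_tail_dependence_le\<close>, \<open>first_last_margin_near_independence\<close>).

  If a copula is within \<open>e\<close> of \<open>u * v\<close>, then Spearman's rho is at most \<open>12 * e\<close> and Kendall's tau at most
  \<open>8 * e\<close> in absolute value (\<open>spearman_rho_le\<close>, \<open>kendall_tau_le\<close>). The second bound rests on Hoeffding's
  identity \<open>integral_joint_cdf\<close>, which trades an integral with respect to the copula for one with respect to
  Lebesgue measure.
\<close>

section \<open>The largest Poisson probability\<close>

text \<open>
  The largest value over \<open>x \<ge> 0\<close> of the Poisson probability \<open>exp (- x) * x ^ n / fact n\<close>; it is
  attained at \<open>x = n\<close>.
\<close>
definition poisson_peak :: "nat \<Rightarrow> real" where
  "poisson_peak n = real n ^ n * exp (- real n) / fact n"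

text \<open>
  With \<open>y = x / n\<close> this is the \<open>n\<close>-th power of \<open>y \<le> exp (y - 1)\<close>.
\<close>
lemma poisson_weight_le_peak:
  fixes x :: real
  assumes "x \<ge> 0"
  shows "exp (- x) * x ^ n / fact n \<le> poisson_peak n"
proof (cases "n = 0")
  case True
  then show ?thesis using assms by (simp add: poisson_peak_def)
next
  case False
  have "x / n \<le> exp (x / n - 1)"
    using exp_ge_add_one_self[of "x / n - 1"] by simp
  then have "(x / n) ^ n \<le> exp (x / n - 1) ^ n"
    using assms by (intro power_mono) auto
  also have "\<dots> = exp (x - n)"
    using False by (simp add: exp_of_nat_mult[symmetric] algebra_simps)
  finally have "x ^ n \<le> exp (x - n) * real n ^ n"
    using False by (simp add: power_divide divide_simps)
  then have "exp (- x) * x ^ n \<le> exp (- x) * (exp (x - n) * real n ^ n)"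
    by (intro mult_left_mono) auto
  also have "\<dots> = real n ^ n * exp (- real n)"
    by (simp add: exp_diff exp_minus field_simps)
  finally show ?thesis
    unfolding poisson_peak_def by (intro divide_right_mono) auto
qed

lemma poisson_peak_nonneg: "poisson_peak n \<ge> 0"
  by (simp add: poisson_peak_def)

text \<open>
  The probabilities of \<open>n, \<dots>, n + m - 1\<close> under the Poisson distribution with mean \<open>n\<close> add up to at most
  \<open>1\<close>, and none of them is much smaller than the largest one: the probability of \<open>n + j\<close> arises from that
  of \<open>n\<close> by multiplication with \<open>j\<close> factors \<open>n / (n + i)\<close>, each at least \<open>n / (n + m)\<close>. For fixed \<open>m\<close> and
  large \<open>n\<close> the bound reads \<open>poisson_peak n \<le> 1 / m\<close> up to a factor close to
  \<open>1\<close>.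
\<close>
lemma poisson_peak_bound:
  shows "poisson_peak n * real m * (real n / real (n + m)) ^ m \<le> 1"
proof (cases "n = 0")
  case True
  then show ?thesis by (cases m) (auto simp: poisson_peak_def)
next
  case False
  have term_ge: "real n ^ n / fact n * (real n / real (n + m)) ^ m \<le> real n ^ (n + j) / fact (n + j)"
    if "j < m" for j
  proof -
    have f: "fact (n + j) \<le> (fact n * real (n + m) ^ j :: real)" if "j \<le> m" for j
      using that
    proof (induction j)
      case (Suc j)
      have "fact (n + Suc j) = real (n + Suc j) * fact (n + j)" by simp
      also have "\<dots> \<le> real (n + m) * (fact n * real (n + m) ^ j)"
        using Suc by (intro mult_mono) auto
      finally show ?case by (simp add: algebra_simps)
    qed simp
    have "real n ^ n / fact n * (real n / real (n + m)) ^ m \<le> real n ^ n / fact n * (real n / real (n + m)) ^ j"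
      using that by (intro mult_left_mono power_decreasing) auto
    also have "\<dots> = real n ^ (n + j) / (fact n * real (n + m) ^ j)"
      by (simp add: power_add power_divide)
    also have "\<dots> \<le> real n ^ (n + j) / fact (n + j)"
      using f[of j] that by (intro divide_left_mono) auto
    finally show ?thesis .
  qed
  have "real m * (real n ^ n / fact n * (real n / real (n + m)) ^ m) =
      (\<Sum>j<m. real n ^ n / fact n * (real n / real (n + m)) ^ m)"
    by simp
  also have "\<dots> \<le> (\<Sum>j<m. real n ^ (n + j) / fact (n + j))"
    using term_ge by (intro sum_mono) auto
  also have "\<dots> = (\<Sum>k\<in>(+) n ` {..<m}. real n ^ k / fact k)"
    by (subst sum.reindex) auto
  also have "\<dots> \<le> exp (real n)"
  proof -
    have "(\<lambda>k. real n ^ k / fact k) sums exp (real n)"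
      using exp_converges[of "real n"] by (simp add: field_simps)
    then show ?thesis
      by (metis (no_types, lifting) finite_imageI finite_lessThan divide_nonneg_pos fact_gt_zero
          of_nat_0_le_iff sum_le_suminf sums_iff zero_le_power)
  qed
  finally have "real m * (real n ^ n / fact n * (real n / real (n + m)) ^ m) * exp (- real n)
      \<le> exp (real n) * exp (- real n)"
    by (intro mult_right_mono) auto
  then show ?thesis
    unfolding poisson_peak_def by (simp add: exp_minus_inverse mult_ac)
qed

lemma LIMSEQ_n_over_n_plus_m: "(\<lambda>n. real n / real (n + m)) \<longlonglongrightarrow> 1"
proof -
  have "(\<lambda>n. 1 - real m * inverse (real (n + m))) \<longlonglongrightarrow> 1 - real m * 0"
    by (intro tendsto_intros LIMSEQ_ignore_initial_segment lim_inverse_n)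
  moreover have "eventually (\<lambda>n. 1 - real m * inverse (real (n + m)) = real n / real (n + m)) sequentially"
    using eventually_gt_at_top[of 0] by eventually_elim (simp add: field_simps)
  ultimately show ?thesis by (auto intro: Lim_transform_eventually)
qed

lemma poisson_peak_tendsto_0: "poisson_peak \<longlonglongrightarrow> 0"
proof (rule LIMSEQ_I)
  fix e :: real assume "e > 0"
  obtain m :: nat where m: "real m > 2 / e" "m > 0"
    by (metis \<open>0 < e\<close> divide_pos_pos gr0I of_nat_0 order_less_asym reals_Archimedean2 zero_less_numeral)
  have "(\<lambda>n. (real n / real (n + m)) ^ m) \<longlonglongrightarrow> 1 ^ m"
    by (intro tendsto_power LIMSEQ_n_over_n_plus_m)
  (* any constant below 1 would do; 1 / 2 matches the choice m > 2 / e *)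
  then have "eventually (\<lambda>n. (real n / real (n + m)) ^ m > 1 / 2) sequentially"
    by (intro order_tendstoD) auto
  then have "eventually (\<lambda>n. norm (poisson_peak n - 0) < e) sequentially"
  proof eventually_elim
    case (elim n)
    have "poisson_peak n * real m * (1 / 2) \<le> poisson_peak n * real m * (real n / real (n + m)) ^ m"
      using elim poisson_peak_nonneg[of n] by (intro mult_left_mono) auto
    also have "\<dots> \<le> 1" by (rule poisson_peak_bound)
    finally have "poisson_peak n \<le> 2 / real m"
      using m(2) by (simp add: field_simps)
    also have "\<dots> < e" using m \<open>e > 0\<close> by (simp add: field_simps)
    finally show ?case using poisson_peak_nonneg[of n] by simp
  qed
  then show "\<exists>no. \<forall>n\<ge>no. norm (poisson_peak n - 0) < e"
    by (simp add: eventually_sequentially)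
qed

section \<open>Joint tails of Poisson arrival times\<close>

text \<open>
  Let \<open>T\<^sub>1 < T\<^sub>2 < \<dots>\<close> be the arrival times of a Poisson process of rate \<open>1\<close>. For \<open>n \<ge> 1\<close> and \<open>t \<ge> 0\<close> this
  is the probability of \<open>T\<^sub>1 \<ge> t \<and> T\<^sub>n \<ge> s\<close>: the process has no arrival before \<open>t\<close> and fewer than \<open>n\<close>
  arrivals between \<open>t\<close> and \<open>s\<close>. For \<open>n = 0\<close> the sum is empty, and the value is the function
  \<open>exp (- t)\<close> cut off below \<open>s\<close>, from which the cases \<open>n \<ge> 1\<close> arise by iterated integration.
\<close>
definition arrival_tail :: "nat \<Rightarrow> real \<Rightarrow> real \<Rightarrow> real" where
  "arrival_tail n s t =
     (if t < s then exp (- s) * (\<Sum>i<n. (s - t) ^ i / fact i) else exp (- t))"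

lemma arrival_tail_nonneg: "arrival_tail n s t \<ge> 0"
  by (auto simp: arrival_tail_def intro!: mult_nonneg_nonneg sum_nonneg)

lemma sum_power_fact_has_derivative:
  "((\<lambda>t. \<Sum>i<Suc n. (s - t) ^ i / fact i) has_real_derivative - (\<Sum>i<n. (s - t) ^ i / fact i)) (at t)"
  for s t :: real
proof -
  have "((\<lambda>t. (s - t) ^ Suc i / fact (Suc i)) has_real_derivative - ((s - t) ^ i / fact i)) (at t)" for i
    by (rule derivative_eq_intros refl | simp del: of_nat_Suc power_Suc)+
  then have "((\<lambda>t. 1 + (\<Sum>i<n. (s - t) ^ Suc i / fact (Suc i))) has_real_derivative
      0 + (\<Sum>i<n. - ((s - t) ^ i / fact i))) (at t)"
    by (intro derivative_intros)
  then show ?thesis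
    by (simp only: sum.lessThan_Suc_shift sum_negf) simp
qed

text \<open>
  Integrating over the position of one more arrival raises \<open>n\<close> by one. Below \<open>s\<close> the functions are
  exponential partial sums in \<open>s - t\<close>, each an antiderivative of its predecessor; above \<open>s\<close> all of them
  are \<open>exp (- t)\<close>.
\<close>
lemma arrival_tail_has_integral:
  "(arrival_tail n s has_integral arrival_tail (Suc n) s r) {r..}"
proof -
  have exp_int: "(arrival_tail n s has_integral exp (- t)) {t..}" if "t \<ge> s" for t
    using has_integral_exp_minus_to_infinity[of 1 t] that
    by (subst has_integral_cong[where g = "\<lambda>x. exp (- x)"]) (auto simp: arrival_tail_def)
  show ?thesis
  proof (cases "r < s")
    case False
    then show ?thesis using exp_int[of r] by (simp add: arrival_tail_def)
  next
    case True
    define F where "F t = - exp (- s) * (\<Sum>i<Suc n. (s - t) ^ i / fact i)" for t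
    define f where "f t = exp (- s) * (\<Sum>i<n. (s - t) ^ i / fact i)" for t
    have "(F has_real_derivative - exp (- s) * - (\<Sum>i<n. (s - t) ^ i / fact i)) (at t)" for t
      unfolding F_def by (intro DERIV_cmult sum_power_fact_has_derivative)
    then have "(f has_integral F s - F r) {r..s}"
      using True unfolding f_def
      by (intro fundamental_theorem_of_calculus)
        (auto simp: has_real_derivative_iff_has_vector_derivative[symmetric] intro: DERIV_subset)
    (* at t = s the function jumps if n = 0 *)
    then have "(arrival_tail n s has_integral F s - F r) {r..s}"
      by (rule has_integral_spike_finite[rotated 2, where S = "{s}"])
        (auto simp: arrival_tail_def f_def)
    moreover have "{r..s} \<inter> {s..} = {s}" "{r..s} \<union> {s..} = {r..}"
      using True by auto
    ultimately have "(arrival_tail n s has_integral F s - F r + exp (- s)) {r..}"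
      using has_integral_Un[of "arrival_tail n s" "F s - F r" "{r..s}" "exp (- s)" "{s..}"] exp_int[of s]
      by simp
    moreover have "F s = - exp (- s)"
      unfolding F_def by (simp only: sum.lessThan_Suc_shift) simp
    ultimately show ?thesis using True
      by (simp add: arrival_tail_def F_def)
  qed
qed

lemma arrival_tail_origin:
  "s \<ge> 0 \<Longrightarrow> n \<ge> 1 \<Longrightarrow> arrival_tail n s 0 = exp (- s) * (\<Sum>i<n. s ^ i / fact i)"
  by (cases n) (auto simp: arrival_tail_def sum.lessThan_Suc_shift simp del: sum.lessThan_Suc)

text \<open>
  Given that nothing arrives before \<open>r\<close>, the process starts afresh at \<open>r\<close>.
\<close>
lemma arrival_tail_memoryless:
  assumes "n \<ge> 1" "0 \<le> r"
  shows "arrival_tail n s r = exp (- r) * arrival_tail n (max 0 (s - r)) 0"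
proof (cases "r < s")
  case True
  then show ?thesis
    using assms by (simp add: arrival_tail_def max_def flip: exp_add mult.assoc)
next
  case False
  then show ?thesis by (simp add: arrival_tail_def max_def)
qed

text \<open>
  The derivative telescopes to the negative of the density of the gamma distribution of \<open>T\<^sub>n\<^sub>+\<^sub>1\<close>, which is
  the Poisson probability of \<open>n\<close>.
\<close>
lemma arrival_tail_origin_has_derivative:
  assumes "s > 0"
  shows "((\<lambda>s. arrival_tail (Suc n) s 0) has_real_derivative - (exp (- s) * s ^ n / fact n)) (at s)"
proof -
  have "((\<lambda>x. (\<Sum>i<Suc n. x ^ i / fact i)) has_real_derivative (\<Sum>i<n. s ^ i / fact i)) (at s)"
    using DERIV_mirror[of "\<lambda>t. \<Sum>i<Suc n. (0 - t) ^ i / fact i" "- (\<Sum>i<n. s ^ i / fact i)" "s"]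
      sum_power_fact_has_derivative[of 0 n "- s"] 
    by simp
  from DERIV_mult[OF _ this, of "\<lambda>s. exp (- s)" "- exp (- s)"]
  have "((\<lambda>s. exp (- s) * (\<Sum>i<Suc n. s ^ i / fact i)) has_real_derivative
      - (exp (- s) * s ^ n / fact n)) (at s)"
    by (rule DERIV_cong) (auto intro!: derivative_eq_intros simp: algebra_simps)
  moreover have "eventually (\<lambda>x. exp (- x) * (\<Sum>i<Suc n. x ^ i / fact i) = arrival_tail (Suc n) x 0) (nhds s)"
    using eventually_nhds_in_open[of "{0<..}" s] assms
    by (auto elim!: eventually_mono simp: arrival_tail_origin)
  ultimately show ?thesis
    by (rule iffD1[OF DERIV_cong_ev[OF refl _ refl], rotated])
qed

lemma continuous_on_arrival_tail_origin:
  assumes "n \<ge> 1"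
  shows "continuous_on {0..} (\<lambda>s. arrival_tail n s 0)"
proof -
  have "continuous_on {0..} (\<lambda>s. exp (- s) * (\<Sum>i<n. s ^ i / fact i) :: real)"
    by (intro continuous_intros) auto
  then show ?thesis
    using assms by (subst continuous_on_cong[OF refl arrival_tail_origin]) auto
qed

lemma arrival_tail_origin_tendsto_0: "((\<lambda>s. arrival_tail n s 0) \<longlongrightarrow> 0) at_top"
proof -
  have "((\<lambda>s::real. \<Sum>i<n. (s ^ i / exp s) / fact i) \<longlongrightarrow> (\<Sum>i<n. 0 / fact i)) at_top"
    by (intro tendsto_sum tendsto_divide tendsto_power_div_exp_0) auto
  moreover have "eventually (\<lambda>s::real. (\<Sum>i<n. (s ^ i / exp s) / fact i) = arrival_tail n s 0) at_top"
    using eventually_gt_at_top[of 0]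
    by eventually_elim (auto simp: arrival_tail_def sum_distrib_left exp_minus field_simps intro!: sum.cong)
  ultimately show ?thesis
    by (auto intro: Lim_transform_eventually)
qed

text \<open>
  Every level \<open>v\<close> strictly between \<open>0\<close> and \<open>1\<close> is the probability of \<open>T\<^sub>n \<ge> s\<close> for some \<open>s\<close>; this lets
  the copula be evaluated at an arbitrary point.
\<close>
lemma arrival_tail_origin_onto:
  assumes "n \<ge> 1" "0 < v" "v < 1"
  shows "\<exists>s>0. arrival_tail n s 0 = v"
proof -
  from order_tendstoD(2)[OF arrival_tail_origin_tendsto_0 assms(2)] eventually_gt_at_top[of 0]
  have "eventually (\<lambda>s. arrival_tail n s 0 < v \<and> s > 0) at_top"
    by eventually_elim auto
  then obtain b where b: "arrival_tail n b 0 < v" "b > 0"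
    using eventually_happens by fastforce
  have z: "arrival_tail n 0 0 = 1" by (simp add: arrival_tail_def)
  have "\<exists>s\<ge>0. s \<le> b \<and> arrival_tail n s 0 = v"
    using b assms z
    by (intro IVT2' continuous_on_subset[OF continuous_on_arrival_tail_origin]) auto
  then show ?thesis using z assms by (metis less_eq_real_def less_irrefl)
qed

lemma arrival_tail_origin_diff_le:
  assumes "0 \<le> x" "x \<le> s"
  shows "\<bar>arrival_tail (Suc n) x 0 - arrival_tail (Suc n) s 0\<bar> \<le> (s - x) * poisson_peak n"
proof (cases "x = s")
  case False
  then have "x < s" using assms by simp
  moreover have "continuous_on {x..s} (\<lambda>s. arrival_tail (Suc n) s 0)"
    using assms by (intro continuous_on_subset[OF continuous_on_arrival_tail_origin]) auto
  moreover have "((\<lambda>s. arrival_tail (Suc n) s 0) has_derivative (*) (- (exp (- y) * y ^ n / fact n))) (at y)"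
    if "x < y" for y
    using arrival_tail_origin_has_derivative[of y n] that assms(1)
    by (simp add: has_field_derivative_def)
  ultimately obtain y where y: "x < y" "y < s"
    "arrival_tail (Suc n) s 0 - arrival_tail (Suc n) x 0 = - (exp (- y) * y ^ n / fact n) * (s - x)"
    using mvt[of x s "\<lambda>s. arrival_tail (Suc n) s 0" "\<lambda>y. (*) (- (exp (- y) * y ^ n / fact n))"]
    by auto
  have "\<bar>arrival_tail (Suc n) x 0 - arrival_tail (Suc n) s 0\<bar> = exp (- y) * y ^ n / fact n * (s - x)"
    using y assms by (subst abs_minus_commute, subst y(3)) (simp add: abs_mult)
  also have "\<dots> \<le> poisson_peak n * (s - x)"
    using y assms by (intro mult_right_mono poisson_weight_le_peak) auto
  finally show ?thesis by (simp add: mult.commute)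
qed simp

text \<open>
  The quantitative heart of the matter: \<open>T\<^sub>1\<close> and \<open>T\<^sub>n\<^sub>+\<^sub>1\<close> are almost independent. By memorylessness the
  joint tail differs from the product of the tails only in that the tail of \<open>T\<^sub>n\<^sub>+\<^sub>1\<close> is taken at \<open>s - r\<close>
  instead of \<open>s\<close>. As the density of \<open>T\<^sub>n\<^sub>+\<^sub>1\<close> is bounded by \<open>poisson_peak n\<close>, the difference is at most
  \<open>exp (- r) * r * poisson_peak n\<close>, and \<open>exp (- r) * r \<le> 1\<close>.
\<close>
lemma arrival_tail_dependence_le:
  assumes "0 \<le> r" "0 \<le> s"
  shows "\<bar>arrival_tail (Suc n) s r - exp (- r) * arrival_tail (Suc n) s 0\<bar> \<le> poisson_peak n"
proof -
  have "\<bar>arrival_tail (Suc n) s r - exp (- r) * arrival_tail (Suc n) s 0\<bar> =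
      exp (- r) * \<bar>arrival_tail (Suc n) (max 0 (s - r)) 0 - arrival_tail (Suc n) s 0\<bar>"
    using assms by (subst arrival_tail_memoryless) (auto simp: abs_mult simp flip: right_diff_distrib)
  also have "\<dots> \<le> exp (- r) * ((s - max 0 (s - r)) * poisson_peak n)"
    using assms by (intro mult_left_mono arrival_tail_origin_diff_le) auto
  also have "\<dots> \<le> exp (- r) * (r * poisson_peak n)"
    using assms poisson_peak_nonneg[of n] by (intro mult_left_mono mult_right_mono) auto
  also have "\<dots> \<le> poisson_peak n"
  proof -
    have "r \<le> exp r" using exp_ge_add_one_self[of r] by linarith
    then have "exp (- r) * r \<le> 1" by (simp add: exp_minus field_simps)
    then show ?thesis
      using mult_right_mono[OF _ poisson_peak_nonneg[of n], of "exp (- r) * r" 1] by (simp add: mult_ac)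
  qed
  finally show ?thesis .
qed

section \<open>The transformation to arrival times\<close>

locale mgev_params =
  fixes \<mu> \<sigma> \<xi> :: real
  assumes \<sigma>_pos: "\<sigma> > 0"
begin

text \<open>
  The common range of the coordinates of the points of \<open>mgev_domain\<close>, which is the whole line for
  \<open>\<xi> = 0\<close> and a half line otherwise.
\<close>
definition supp :: "real set" where
  "supp = {z. \<xi> * ((z - \<mu>) / \<sigma>) > -1}"

abbreviation \<Lambda> :: "real \<Rightarrow> real" where
  "\<Lambda> \<equiv> mgev_Lambda \<mu> \<sigma> \<xi>"

text \<open>
  On \<open>supp\<close> this is the negative derivative of \<open>\<Lambda>\<close>; the formula covers \<open>\<xi> = 0\<close> and \<open>\<xi> \<noteq> 0\<close> at once and is
  visibly measurable.
\<close>
definition rate :: "real \<Rightarrow> real" where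
  "rate z = \<Lambda> z powr (1 + \<xi>) / \<sigma>"

lemma rate_nonneg: "rate z \<ge> 0"
  using \<sigma>_pos by (simp add: rate_def)

lemma supp_measurable [measurable]: "supp \<in> sets borel"
  unfolding supp_def by measurable

lemma \<Lambda>_measurable [measurable]: "\<Lambda> \<in> borel_measurable borel"
  unfolding mgev_Lambda_def by measurable

lemma rate_measurable [measurable]: "rate \<in> borel_measurable borel"
  unfolding rate_def by measurable

lemma open_supp: "open supp"
  unfolding supp_def using \<sigma>_pos by (intro open_Collect_less continuous_intros) auto

lemma \<Lambda>_pos: "z \<in> supp \<Longrightarrow> \<Lambda> z > 0"
  by (auto simp: mgev_Lambda_def supp_def)

lemma \<Lambda>_has_derivative:
  assumes "z \<in> supp"
  shows "(\<Lambda> has_real_derivative - rate z) (at z)"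
proof (cases "\<xi> = 0")
  case True
  have "((\<lambda>z. exp (- ((z - \<mu>) / \<sigma>))) has_real_derivative - rate z) (at z)"
    using \<sigma>_pos True unfolding rate_def mgev_Lambda_def
    by (auto intro!: derivative_eq_intros)
  then show ?thesis using True by (simp add: mgev_Lambda_def[abs_def])
next
  case False
  define w where "w = 1 + \<xi> * ((z - \<mu>) / \<sigma>)"
  have w: "w > 0" using assms by (simp add: w_def supp_def)
  have "((\<lambda>z. (1 + \<xi> * ((z - \<mu>) / \<sigma>)) powr (- 1 / \<xi>)) has_real_derivative
      (- 1 / \<xi>) * w powr (- 1 / \<xi> - 1) * (\<xi> / \<sigma>)) (at z)"
    using w \<sigma>_pos unfolding w_def by (auto intro!: derivative_eq_intros)
  also have "(- 1 / \<xi>) * w powr (- 1 / \<xi> - 1) * (\<xi> / \<sigma>) = - (w powr (- 1 / \<xi> - 1) / \<sigma>)"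
    using False by simp
  also have "w powr (- 1 / \<xi> - 1) = (w powr (- 1 / \<xi>)) powr (1 + \<xi>)"
    using False by (simp add: powr_powr distrib_left)
  also have "- ((w powr (- 1 / \<xi>)) powr (1 + \<xi>) / \<sigma>) = - rate z"
    using False w by (simp add: rate_def mgev_Lambda_def w_def)
  finally have "((\<lambda>z. (1 + \<xi> * ((z - \<mu>) / \<sigma>)) powr (- 1 / \<xi>)) has_real_derivative - rate z) (at z)" .
  moreover have "eventually (\<lambda>z. (1 + \<xi> * ((z - \<mu>) / \<sigma>)) powr (- 1 / \<xi>) = \<Lambda> z) (nhds z)"
    using eventually_nhds_in_open[OF open_supp assms] False
    by (auto elim!: eventually_mono simp: mgev_Lambda_def supp_def)
  ultimately show ?thesis
    by (rule iffD1[OF DERIV_cong_ev[OF refl _ refl], rotated])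
qed

lemma deriv_\<Lambda>: "z \<in> supp \<Longrightarrow> deriv \<Lambda> z = - rate z"
  by (rule DERIV_imp_deriv[OF \<Lambda>_has_derivative])

lemma \<Lambda>_strict_antimono:
  assumes "z \<in> supp" "w \<in> supp" "z < w"
  shows "\<Lambda> w < \<Lambda> z"
proof (cases "\<xi> = 0")
  case True
  then show ?thesis using assms \<sigma>_pos by (simp add: mgev_Lambda_def divide_strict_right_mono)
next
  case False
  have pos: "1 + \<xi> * ((z - \<mu>) / \<sigma>) > 0" "1 + \<xi> * ((w - \<mu>) / \<sigma>) > 0"
    using assms by (auto simp: supp_def)
  have less: "(z - \<mu>) / \<sigma> < (w - \<mu>) / \<sigma>"
    using assms \<sigma>_pos by (simp add: divide_strict_right_mono)
  have "(1 + \<xi> * ((w - \<mu>) / \<sigma>)) powr (- 1 / \<xi>) < (1 + \<xi> * ((z - \<mu>) / \<sigma>)) powr (- 1 / \<xi>)"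
  proof (cases "\<xi> > 0")
    case True
    then have "\<xi> * ((z - \<mu>) / \<sigma>) < \<xi> * ((w - \<mu>) / \<sigma>)"
      using less by (rule mult_strict_left_mono[rotated])
    then show ?thesis using True pos by (intro powr_less_mono2_neg) auto
  next
    case False
    with \<open>\<xi> \<noteq> 0\<close> have "\<xi> < 0" by simp
    then have "\<xi> * ((w - \<mu>) / \<sigma>) < \<xi> * ((z - \<mu>) / \<sigma>)"
      using less by (rule mult_strict_left_mono_neg[rotated])
    then show ?thesis using \<open>\<xi> < 0\<close> pos by (intro powr_less_mono2) (auto simp: divide_neg_neg)
  qed
  then show ?thesis using False pos by (simp add: mgev_Lambda_def)
qed

lemma \<Lambda>_less_iff: "z \<in> supp \<Longrightarrow> w \<in> supp \<Longrightarrow> \<Lambda> w < \<Lambda> z \<longleftrightarrow> z < w"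
  using \<Lambda>_strict_antimono[of z w] \<Lambda>_strict_antimono[of w z] by (metis less_asym less_linear)

lemma inj_on_\<Lambda>: "inj_on \<Lambda> supp"
  using \<Lambda>_less_iff by (metis inj_onI less_irrefl linorder_neqE)

lemma \<Lambda>_onto:
  assumes "t > 0"
  shows "\<exists>z\<in>supp. \<Lambda> z = t"
proof (cases "\<xi> = 0")
  case True
  then show ?thesis using assms \<sigma>_pos unfolding mgev_Lambda_def supp_def
    by (intro bexI[of _ "\<mu> - \<sigma> * ln t"]) auto
next
  case False
  define z where "z = \<mu> + \<sigma> * ((t powr (- \<xi>) - 1) / \<xi>)"
  have "1 + \<xi> * ((z - \<mu>) / \<sigma>) = t powr (- \<xi>)"
    using False \<sigma>_pos by (simp add: z_def)
  moreover have "t powr (- \<xi>) > 0" using assms by simp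
  moreover have "(t powr (- \<xi>)) powr (- 1 / \<xi>) = t"
    using False assms by (simp add: powr_powr)
  moreover from calculation have "\<xi> * ((z - \<mu>) / \<sigma>) > -1" by linarith
  ultimately show ?thesis using False unfolding mgev_Lambda_def supp_def
    by (intro bexI[of _ z]) simp_all
qed

lemma image_\<Lambda>: "T \<subseteq> {0<..} \<Longrightarrow> \<Lambda> ` {z\<in>supp. \<Lambda> z \<in> T} = T"
proof safe
  fix t assume "T \<subseteq> {0<..}" "t \<in> T"
  then obtain z where "z \<in> supp" "\<Lambda> z = t" using \<Lambda>_onto[of t] by auto
  then show "t \<in> \<Lambda> ` {z\<in>supp. \<Lambda> z \<in> T}" using \<open>t \<in> T\<close> by auto
qed

text \<open>
  The substitution \<open>t = \<Lambda> w\<close> maps \<open>supp\<close> onto the positive half line and turns \<open>rate w\<close> times Lebesgue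
  measure into Lebesgue measure. The set \<open>T\<close> stands for either \<open>{r<..}\<close> or \<open>{r..}\<close>: coordinates are
  compared strictly with each other, but weakly with the arguments of distribution functions.
\<close>
lemma nn_integral_arrival_tail:
  assumes T: "T \<in> sets borel" "{r<..} \<subseteq> T" "T \<subseteq> {r..}" "r \<ge> 0"
  shows "(\<integral>\<^sup>+ w. indicator {w\<in>supp. \<Lambda> w \<in> T} w * ennreal (rate w * arrival_tail n s (\<Lambda> w)) \<partial>lborel)
    = arrival_tail (Suc n) s r"
proof -
  (* T may contain 0, which is not a value of \<Lambda> on supp *)
  define T' where "T' = T \<inter> {0<..}"
  have T': "T' \<subseteq> {0<..}" "{r<..} \<subseteq> T'" "T' \<subseteq> {r..}" using T by (auto simp: T'_def)
  define S where "S = {w\<in>supp. \<Lambda> w \<in> T'}"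
  have S_eq: "S = {w\<in>supp. \<Lambda> w \<in> T}" using \<Lambda>_pos by (auto simp: S_def T'_def)
  have [measurable]: "T' \<in> sets borel" using T by (auto simp: T'_def)
  have "S \<in> sets borel"
    unfolding S_def using measurable_sets_borel[OF \<Lambda>_measurable, of T'] supp_measurable
    by (auto simp: vimage_def Collect_conj_eq)
  then have S_lebesgue: "S \<in> sets lebesgue" by auto
  have "(arrival_tail n s has_integral arrival_tail (Suc n) s r) T'"
  proof (rule iffD2[OF has_integral_spike_set_eq arrival_tail_has_integral])
    show "negligible {x \<in> T' - {r..}. arrival_tail n s x \<noteq> 0}"
      by (rule negligible_subset[of "{r}"]) (use T' in auto)
    show "negligible {x \<in> {r..} - T'. arrival_tail n s x \<noteq> 0}"
      by (rule negligible_subset[of "{r}"]) (use T'(2) in \<open>auto simp: subset_iff less_le\<close>)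
  qed
  then have "arrival_tail n s absolutely_integrable_on T' \<and> integral T' (arrival_tail n s) = arrival_tail (Suc n) s r"
    using arrival_tail_nonneg by (auto intro: nonnegative_absolutely_integrable_1 has_integral_integrable)
  then have "arrival_tail n s absolutely_integrable_on \<Lambda> ` S \<and> integral (\<Lambda> ` S) (arrival_tail n s) = arrival_tail (Suc n) s r"
    unfolding S_def image_\<Lambda>[OF T'(1)] .
  then have "(\<lambda>w. \<bar>- rate w\<bar> * arrival_tail n s (\<Lambda> w)) absolutely_integrable_on S \<and>
      integral S (\<lambda>w. \<bar>- rate w\<bar> * arrival_tail n s (\<Lambda> w)) = arrival_tail (Suc n) s r"
    by (rule iffD2[OF has_absolute_integral_change_of_variables_1'[OF S_lebesgue, where f = "arrival_tail n s"], rotated 2])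
      (auto simp: S_def intro: inj_on_subset[OF inj_on_\<Lambda>] DERIV_subset[OF \<Lambda>_has_derivative])
  then have "((\<lambda>w. rate w * arrival_tail n s (\<Lambda> w)) has_integral arrival_tail (Suc n) s r) S"
    using rate_nonneg by (auto simp: set_lebesgue_integral_eq_integral(1) has_integral_iff)
  from nn_integral_has_integral_lebesgue'[OF _ this]
  have "(\<integral>\<^sup>+ w. ennreal (rate w * arrival_tail n s (\<Lambda> w)) * indicator S w \<partial>lborel) = arrival_tail (Suc n) s r"
    using rate_nonneg arrival_tail_nonneg by auto
  then show ?thesis by (simp add: S_eq mult.commute)
qed

end

section \<open>The first and the last coordinate of the MGEV distribution\<close>

definition decreasing_upto :: "nat \<Rightarrow> (nat \<Rightarrow> real) \<Rightarrow> bool" where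
  "decreasing_upto n y \<longleftrightarrow> (\<forall>i\<in>{1..n}. \<forall>j\<in>{1..n}. i < j \<longrightarrow> y i > y j)"

lemma decreasing_upto_Suc:
  "decreasing_upto (Suc (Suc k)) (y(Suc (Suc k) := w)) \<longleftrightarrow> decreasing_upto (Suc k) y \<and> w < y (Suc k)"
proof
  assume L: "decreasing_upto (Suc (Suc k)) (y(Suc (Suc k) := w))"
  have "y i > y j" if "i \<in> {1..Suc k}" "j \<in> {1..Suc k}" "i < j" for i j
    using L that unfolding decreasing_upto_def
    by (metis atLeastAtMost_iff fun_upd_other le_SucI not_less_eq_eq order_refl)
  moreover have "w < y (Suc k)"
    using L[unfolded decreasing_upto_def, rule_format, of "Suc k" "Suc (Suc k)"] by simp
  ultimately show "decreasing_upto (Suc k) y \<and> w < y (Suc k)"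
    by (auto simp: decreasing_upto_def)
next
  assume R: "decreasing_upto (Suc k) y \<and> w < y (Suc k)"
  have "w < y i" if "i \<in> {1..Suc k}" for i
  proof (cases "i = Suc k")
    case False
    then have "y (Suc k) < y i"
      using R that by (auto simp: decreasing_upto_def)
    then show ?thesis using R by simp
  qed (use R in simp)
  then show "decreasing_upto (Suc (Suc k)) (y(Suc (Suc k) := w))"
    using R by (auto simp: decreasing_upto_def le_Suc_eq)
qed

lemma decreasing_upto_measurable [measurable]:
  "Measurable.pred (PiM {1..n} (\<lambda>_. lborel)) (decreasing_upto n)"
  unfolding decreasing_upto_def by measurable

definition integrate_below :: "(real \<Rightarrow> ennreal) \<Rightarrow> (real \<Rightarrow> ennreal) \<Rightarrow> real \<Rightarrow> ennreal" where
  "integrate_below g f z = (\<integral>\<^sup>+ w. g w * (if w < z then f w else 0) \<partial>lborel)"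

lemma integrate_below_measurable [measurable]:
  assumes [measurable]: "g \<in> borel_measurable borel" "f \<in> borel_measurable borel"
  shows "integrate_below g f \<in> borel_measurable borel"
  unfolding integrate_below_def by measurable

text \<open>
  Fubini's theorem, integrating out the last coordinate first. In a decreasing vector the last coordinate is
  bounded only by its predecessor, so each integration replaces the factor \<open>f\<close> at the last coordinate by
  \<open>integrate_below g f\<close> at the one before it. A factor \<open>h\<close> at the first coordinate survives until the end.
\<close>
lemma nn_integral_PiM_decreasing:
  assumes [measurable]: "g \<in> borel_measurable borel" "h \<in> borel_measurable borel"
  assumes "f \<in> borel_measurable borel"
  shows "(\<integral>\<^sup>+ y. (if decreasing_upto (Suc k) y then 1 else 0) * h (y 1) * f (y (Suc k)) *
      (\<Prod>i=1..Suc k. g (y i)) \<partial>PiM {1..Suc k} (\<lambda>_. lborel))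
    = (\<integral>\<^sup>+ w. g w * (h w * (integrate_below g ^^ k) f w) \<partial>lborel)"
  using assms(3)
proof (induction k arbitrary: f)
  case (0 f)
  note [measurable] = 0
  interpret product_sigma_finite "\<lambda>_::nat. lborel :: real measure" ..
  have "(\<integral>\<^sup>+ y. h (y 1) * f (y 1) * g (y 1) \<partial>PiM {1::nat} (\<lambda>_. lborel)) = (\<integral>\<^sup>+ w. h w * f w * g w \<partial>lborel)"
    by (subst product_nn_integral_singleton[of "\<lambda>w. h w * f w * g w" 1]) auto
  then show ?case by (simp add: decreasing_upto_def mult_ac)
next
  case (Suc k f)
  note [measurable] = Suc.prems
  let ?n = "Suc k"
  interpret product_sigma_finite "\<lambda>_::nat. lborel :: real measure" ..
  let ?F = "\<lambda>n f y. (if decreasing_upto n y then 1 else 0) * h (y 1) * f (y n) * (\<Prod>i=1..n. g (y i)) :: ennreal"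
  have ins: "{1..Suc ?n} = insert (Suc ?n) {1..?n}" by auto
  have meas: "?F (Suc ?n) f \<in> borel_measurable (PiM {1..Suc ?n} (\<lambda>_. lborel))"
    by measurable
  have "integral\<^sup>N (PiM {1..Suc ?n} (\<lambda>_. lborel)) (?F (Suc ?n) f) =
    (\<integral>\<^sup>+ x. (\<integral>\<^sup>+ w. ?F (Suc ?n) f (x(Suc ?n := w)) \<partial>lborel) \<partial>PiM {1..?n} (\<lambda>_. lborel))"
    using meas unfolding ins by (intro product_nn_integral_insert) auto
  also have "\<dots> = (\<integral>\<^sup>+ x. ?F ?n (integrate_below g f) x \<partial>PiM {1..?n} (\<lambda>_. lborel))"
  proof (rule nn_integral_cong)
    fix x :: "nat \<Rightarrow> real"
    have "(\<Prod>i=1..?n. g ((x(Suc ?n := w)) i)) = (\<Prod>i=1..?n. g (x i))" for w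
      by (intro prod.cong) auto
    then have "?F (Suc ?n) f (x(Suc ?n := w)) =
      ((if decreasing_upto ?n x then 1 else 0) * h (x 1) * (\<Prod>i=1..?n. g (x i))) *
        (g w * (if w < x ?n then f w else 0))" for w
      unfolding decreasing_upto_Suc by (simp add: mult_ac)
    then have "(\<integral>\<^sup>+ w. ?F (Suc ?n) f (x(Suc ?n := w)) \<partial>lborel) =
      (\<integral>\<^sup>+ w. ((if decreasing_upto ?n x then 1 else 0) * h (x 1) * (\<Prod>i=1..?n. g (x i))) *
        (g w * (if w < x ?n then f w else 0)) \<partial>lborel)"
      by (intro nn_integral_cong)
    also have "\<dots> = ((if decreasing_upto ?n x then 1 else 0) * h (x 1) * (\<Prod>i=1..?n. g (x i))) *
        integrate_below g f (x ?n)"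
      unfolding integrate_below_def by (rule nn_integral_cmult) measurable
    finally show "(\<integral>\<^sup>+ w. ?F (Suc ?n) f (x(Suc ?n := w)) \<partial>lborel) = ?F ?n (integrate_below g f) x"
      by (simp only: mult_ac)
  qed
  also have "\<dots> = (\<integral>\<^sup>+ w. g w * (h w * (integrate_below g ^^ k) (integrate_below g f) w) \<partial>lborel)"
    by (rule Suc.IH) measurable
  finally show ?case by (simp add: funpow_swap1)
qed

context mgev_params
begin

definition supp_rate :: "real \<Rightarrow> ennreal" where
  "supp_rate w = indicator supp w * ennreal (rate w)"

lemma supp_rate_measurable [measurable]: "supp_rate \<in> borel_measurable borel"
  unfolding supp_rate_def by measurable

lemma mem_supp_pos: "\<xi> > 0 \<Longrightarrow> z \<in> supp \<longleftrightarrow> z > \<mu> - \<sigma> / \<xi>"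
  using \<sigma>_pos by (simp add: supp_def field_simps)

lemma mem_supp_neg: "\<xi> < 0 \<Longrightarrow> z \<in> supp \<longleftrightarrow> z < \<mu> - \<sigma> / \<xi>"
  using \<sigma>_pos by (simp add: supp_def field_simps)

lemma mem_supp_zero: "\<xi> = 0 \<Longrightarrow> z \<in> supp"
  unfolding supp_def by simp

text \<open>
  In a decreasing vector the conditions that the domain imposes on \<open>z K\<close> or \<open>z 1\<close> pass to all coordinates.
\<close>
lemma mgev_domain_iff:
  assumes "z \<in> {1..K} \<rightarrow>\<^sub>E UNIV" "K \<ge> 1"
  shows "z \<in> mgev_domain K \<mu> \<sigma> \<xi> \<longleftrightarrow> decreasing_upto K z \<and> (\<forall>i\<in>{1..K}. z i \<in> supp)"
proof (cases "decreasing_upto K z")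
  case True
  have le: "z K \<le> z i" "z i \<le> z 1" if "i \<in> {1..K}" for i
    using True[unfolded decreasing_upto_def, rule_format, of i K]
      True[unfolded decreasing_upto_def, rule_format, of 1 i] that assms(2)
    by (cases "i = K"; cases "i = 1"; force)+
  consider "\<xi> > 0" | "\<xi> < 0" | "\<xi> = 0" by linarith
  then show ?thesis
  proof cases
    case 1
    then have "(\<forall>i\<in>{1..K}. z i \<in> supp) \<longleftrightarrow> z K > \<mu> - \<sigma> / \<xi>"
      using le assms(2) by (fastforce simp: mem_supp_pos intro: less_le_trans)
    then show ?thesis using True assms 1 by (simp add: mgev_domain_def decreasing_upto_def)
  next
    case 2
    then have "(\<forall>i\<in>{1..K}. z i \<in> supp) \<longleftrightarrow> z 1 < \<mu> - \<sigma> / \<xi>"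
      using le assms(2) by (fastforce simp: mem_supp_neg intro: le_less_trans)
    then show ?thesis using True assms 2 by (simp add: mgev_domain_def decreasing_upto_def)
  next
    case 3
    then show ?thesis using True assms mem_supp_zero by (simp add: mgev_domain_def decreasing_upto_def)
  qed
next
  case False
  then show ?thesis by (auto simp: mgev_domain_def decreasing_upto_def)
qed

text \<open>
  The sign \<open>(-1) ^ K\<close> cancels the signs of the derivatives of \<open>\<Lambda>\<close>, so the density is a product of the
  shape treated by the iterated integration above.
\<close>
lemma mgev_density_eq:
  assumes "z \<in> {1..K} \<rightarrow>\<^sub>E UNIV" "K \<ge> 1"
  shows "ennreal (mgev_density K \<mu> \<sigma> \<xi> z) =
    (if decreasing_upto K z then 1 else 0) * ennreal (exp (- \<Lambda> (z K))) * (\<Prod>i=1..K. supp_rate (z i))"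
proof (cases "\<forall>i\<in>{1..K}. z i \<in> supp")
  case True
  have "(\<Prod>j=1..K. deriv \<Lambda> (z j)) = (\<Prod>j=1..K. - rate (z j))"
    using True by (intro prod.cong) (auto simp: deriv_\<Lambda>)
  also have "\<dots> = (-1) ^ K * (\<Prod>j=1..K. rate (z j))"
    by (simp add: prod_uminus)
  finally have eq: "(-1) ^ K * exp (- \<Lambda> (z K)) * (\<Prod>j=1..K. deriv \<Lambda> (z j)) = exp (- \<Lambda> (z K)) * (\<Prod>j=1..K. rate (z j))"
    by (simp flip: power_mult_distrib mult.assoc)
  have "mgev_density K \<mu> \<sigma> \<xi> z = (if decreasing_upto K z then exp (- \<Lambda> (z K)) * (\<Prod>j=1..K. rate (z j)) else 0)"
    unfolding mgev_density_def eq using mgev_domain_iff[OF assms] True by simp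
  moreover have "(\<Prod>i=1..K. supp_rate (z i)) = ennreal (\<Prod>i=1..K. rate (z i))"
    using True rate_nonneg by (auto simp: supp_rate_def prod_ennreal[symmetric] intro!: prod.cong)
  ultimately show ?thesis
    using rate_nonneg by (simp add: ennreal_mult prod_nonneg)
next
  case False
  then obtain i where "i \<in> {1..K}" "z i \<notin> supp" by blast
  then have "(\<Prod>i=1..K. supp_rate (z i)) = 0"
    by (intro prod_zero bexI[of _ i]) (auto simp: supp_rate_def)
  moreover have "z \<notin> mgev_domain K \<mu> \<sigma> \<xi>"
    using mgev_domain_iff[OF assms] False by blast
  ultimately show ?thesis
    by (simp only: mgev_density_def if_False) simp
qed

lemma integrate_below_arrival_tail:
  assumes "\<And>w. w \<in> supp \<Longrightarrow> f w = ennreal (arrival_tail n s (\<Lambda> w))" and "z \<in> supp"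
  shows "integrate_below supp_rate f z = arrival_tail (Suc n) s (\<Lambda> z)"
proof -
  have "integrate_below supp_rate f z =
      (\<integral>\<^sup>+ w. indicator {w\<in>supp. \<Lambda> w \<in> {\<Lambda> z<..}} w * ennreal (rate w * arrival_tail n s (\<Lambda> w)) \<partial>lborel)"
    unfolding integrate_below_def supp_rate_def using assms \<Lambda>_less_iff
    by (intro nn_integral_cong) (auto simp: indicator_def ennreal_mult rate_nonneg arrival_tail_nonneg)
  also have "\<dots> = arrival_tail (Suc n) s (\<Lambda> z)"
    using \<Lambda>_pos[OF assms(2)] by (intro nn_integral_arrival_tail) auto
  finally show ?thesis .
qed

lemma funpow_integrate_below_arrival_tail:
  assumes "\<And>w. w \<in> supp \<Longrightarrow> f w = ennreal (arrival_tail 0 s (\<Lambda> w))" and "z \<in> supp"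
  shows "(integrate_below supp_rate ^^ k) f z = arrival_tail k s (\<Lambda> z)"
  using assms(2)
  by (induction k arbitrary: z) (auto simp: assms(1) integrate_below_arrival_tail)

lemma sets_mgev [measurable_cong]: "sets (mgev K \<mu> \<sigma> \<xi>) = sets (PiM {1..K} (\<lambda>_. borel))"
  by (simp add: mgev_def cong: sets_PiM_cong)

lemma space_mgev: "space (mgev K \<mu> \<sigma> \<xi>) = {1..K} \<rightarrow>\<^sub>E UNIV"
  by (simp add: mgev_def space_PiM)

text \<open>
  The joint distribution of the first and the last coordinate is that of \<open>T\<^sub>1\<close> and \<open>T\<^sub>K\<close> in the variables
  \<open>\<Lambda> (y 1)\<close> and \<open>\<Lambda> (y K)\<close>. The sets \<open>A\<close> and \<open>B\<close> are half lines, or \<open>UNIV\<close> for \<open>r = 0\<close> or \<open>s = 0\<close>, which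
  gives the margins and the total mass from the same formula.
\<close>
lemma emeasure_mgev:
  assumes [measurable]: "A \<in> sets borel" "B \<in> sets borel"
    and A: "\<And>w. w \<in> supp \<Longrightarrow> w \<in> A \<longleftrightarrow> r \<le> \<Lambda> w"
    and B: "\<And>w. w \<in> supp \<Longrightarrow> w \<in> B \<longleftrightarrow> s \<le> \<Lambda> w"
    and "r \<ge> 0" "K \<ge> 1"
  shows "emeasure (mgev K \<mu> \<sigma> \<xi>) {y \<in> space (mgev K \<mu> \<sigma> \<xi>). y 1 \<in> A \<and> y K \<in> B} = arrival_tail K s r"
proof -
  obtain k where K: "K = Suc k" using \<open>K \<ge> 1\<close> by (cases K) auto
  let ?P = "PiM {1..K} (\<lambda>_. lborel :: real measure)"
  let ?X = "{y \<in> space (mgev K \<mu> \<sigma> \<xi>). y 1 \<in> A \<and> y K \<in> B}"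
  define f where "f w = indicator B w * ennreal (exp (- \<Lambda> w))" for w
  have [measurable]: "f \<in> borel_measurable borel" unfolding f_def by measurable
  have dens: "(\<lambda>z. ennreal (mgev_density K \<mu> \<sigma> \<xi> z)) \<in> borel_measurable ?P"
  proof (subst measurable_cong[OF mgev_density_eq])
    show "(\<lambda>z. (if decreasing_upto K z then 1 else 0) * ennreal (exp (- \<Lambda> (z K))) *
        (\<Prod>i=1..K. supp_rate (z i))) \<in> borel_measurable ?P"
      unfolding K by measurable
  qed (use \<open>K \<ge> 1\<close> in \<open>auto simp: space_PiM\<close>)
  have X: "?X \<in> sets ?P"
    unfolding space_mgev by (subst space_PiM[symmetric, where M = "\<lambda>_. lborel", simplified]) (unfold K, measurable)
  have "emeasure (mgev K \<mu> \<sigma> \<xi>) ?X = (\<integral>\<^sup>+ y. ennreal (mgev_density K \<mu> \<sigma> \<xi> y) * indicator ?X y \<partial>?P)"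
    unfolding mgev_def by (rule emeasure_density[OF dens]) (use X in \<open>simp add: mgev_def\<close>)
  also have "\<dots> = (\<integral>\<^sup>+ y. (if decreasing_upto K y then 1 else 0) * indicator A (y 1) * f (y K) *
      (\<Prod>i=1..K. supp_rate (y i)) \<partial>?P)"
  proof (rule nn_integral_cong)
    fix y assume "y \<in> space ?P"
    then have y: "y \<in> {1..K} \<rightarrow>\<^sub>E UNIV" by (simp add: space_PiM)
    show "ennreal (mgev_density K \<mu> \<sigma> \<xi> y) * indicator ?X y = (if decreasing_upto K y then 1 else 0) *
      indicator A (y 1) * f (y K) * (\<Prod>i=1..K. supp_rate (y i))"
      unfolding mgev_density_eq[OF y \<open>K \<ge> 1\<close>] using y
      by (auto simp: f_def space_mgev indicator_def)
  qed
  also have "\<dots> = (\<integral>\<^sup>+ w. supp_rate w * (indicator A w * (integrate_below supp_rate ^^ k) f w) \<partial>lborel)"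
    unfolding K by (rule nn_integral_PiM_decreasing) measurable
  also have "\<dots> = (\<integral>\<^sup>+ w. indicator {w\<in>supp. \<Lambda> w \<in> {r..}} w * ennreal (rate w * arrival_tail k s (\<Lambda> w)) \<partial>lborel)"
  proof (rule nn_integral_cong)
    fix w
    have "w \<in> supp \<Longrightarrow> (integrate_below supp_rate ^^ k) f w = arrival_tail k s (\<Lambda> w)"
      using B by (intro funpow_integrate_below_arrival_tail) (auto simp: f_def arrival_tail_def indicator_def)
    then show "supp_rate w * (indicator A w * (integrate_below supp_rate ^^ k) f w) =
      indicator {w\<in>supp. \<Lambda> w \<in> {r..}} w * ennreal (rate w * arrival_tail k s (\<Lambda> w))"
      using A by (auto simp: supp_rate_def indicator_def ennreal_mult rate_nonneg arrival_tail_nonneg)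
  qed
  also have "\<dots> = arrival_tail K s r"
    unfolding K using \<open>r \<ge> 0\<close> by (intro nn_integral_arrival_tail) auto
  finally show ?thesis .
qed

lemma prob_space_mgev:
  assumes "K \<ge> 1"
  shows "prob_space (mgev K \<mu> \<sigma> \<xi>)"
proof
  show "emeasure (mgev K \<mu> \<sigma> \<xi>) (space (mgev K \<mu> \<sigma> \<xi>)) = 1"
    using emeasure_mgev[of UNIV UNIV 0 0 K] \<Lambda>_pos assms
    by (auto simp: arrival_tail_def less_imp_le)
qed

end

section \<open>Spearman's rho and Kendall's tau near independence\<close>

abbreviation unit_uniform :: "real measure" where
  "unit_uniform \<equiv> uniform_measure lborel {0..1}"

lemma prob_space_unit_uniform: "prob_space unit_uniform"
  by (rule prob_space_uniform_measure) auto

lemma unit_uniform_eq_density: "unit_uniform = density lborel (indicator {0..1})"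
  unfolding uniform_measure_def by (intro density_cong) (auto simp: indicator_def)

lemma AE_unit_uniform: "AE x in unit_uniform. 0 \<le> x \<and> x \<le> 1"
  by (subst AE_uniform_measure) auto

lemma measure_unit_uniform_atMost: "0 \<le> u \<Longrightarrow> u \<le> 1 \<Longrightarrow> measure unit_uniform {..u} = u"
  by (subst measure_uniform_measure) (auto simp: min_def Int_atLeastAtMostL2)

lemma measure_unit_uniform_atLeast: "0 \<le> u \<Longrightarrow> u \<le> 1 \<Longrightarrow> measure unit_uniform {u..} = 1 - u"
  by (subst measure_uniform_measure) (auto simp: Int_atLeastAtMostL1)

lemma integral_unit_uniform:
  fixes f :: "real \<Rightarrow> real"
  assumes [measurable]: "f \<in> borel_measurable borel"
  shows "(LBINT x:{0..1}. f x) = (\<integral>x. f x \<partial>unit_uniform)"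
  unfolding unit_uniform_eq_density set_lebesgue_integral_def ennreal_indicator[symmetric]
  by (subst integral_density) auto

lemma integral_ident_unit_uniform: "(\<integral>x. x \<partial>unit_uniform) = 1 / 2"
proof -
  have "(\<integral>x. x \<partial>unit_uniform) = (LBINT x:{0..1}. x)"
    by (subst integral_unit_uniform) auto
  also have "\<dots> = integral {0..1} (\<lambda>x::real. x)"
    by (intro set_borel_integral_eq_integral borel_integrable_atLeastAtMost') (auto intro: continuous_intros)
  also have "\<dots> = 1 / 2"
    using ident_has_integral[of 0 "1::real"] by (simp add: integral_unique)
  finally show ?thesis .
qed

lemma (in prob_space) abs_integral_diff_le:
  fixes f g :: "'a \<Rightarrow> real"
  assumes "integrable M f" "integrable M g" "AE x in M. \<bar>f x - g x\<bar> \<le> e"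
  shows "\<bar>(\<integral>x. f x \<partial>M) - (\<integral>x. g x \<partial>M)\<bar> \<le> e"
proof -
  have "\<bar>(\<integral>x. f x \<partial>M) - (\<integral>x. g x \<partial>M)\<bar> = \<bar>\<integral>x. f x - g x \<partial>M\<bar>"
    using assms by simp
  also have "\<dots> \<le> (\<integral>x. \<bar>f x - g x\<bar> \<partial>M)"
    by (rule integral_abs_bound)
  also have "\<dots> \<le> (\<integral>x. e \<partial>M)"
    using assms by (intro integral_mono_AE) auto
  finally show ?thesis by (simp add: prob_space)
qed

lemma atMost_pair: "{..a} \<times> {..b} = {..(a, b)}" for a b :: real
  by (auto simp: less_eq_prod_def)

text \<open>
  The quadrants are closed under intersection and generate the Borel sets of the plane.
\<close>
lemma borel_prod_measure_eqI:
  fixes P Q :: "(real \<times> real) measure"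
  assumes "prob_space P" "prob_space Q" "sets P = sets borel" "sets Q = sets borel"
    and eq: "\<And>a b. measure P ({..a} \<times> {..b}) = measure Q ({..a} \<times> {..b})"
  shows "P = Q"
proof -
  interpret P: prob_space P by fact
  interpret Q: prob_space Q by fact
  let ?E = "range (\<lambda>a::real \<times> real. {..a})"
  have gen: "sets borel = sigma_sets UNIV ?E"
    by (subst borel_eq_atMost) simp
  show ?thesis
  proof (rule measure_eqI_generator_eq[where E = ?E and \<Omega> = UNIV and A = "\<lambda>i. {..(real i, real i)}"])
    have "{..a} \<inter> {..b} = {..inf a b}" for a b :: "real \<times> real" by auto
    then show "Int_stable ?E" by (auto simp: Int_stable_def)
    fix X assume "X \<in> ?E"
    then obtain a b where "X = {..(a, b)}" by auto
    then show "emeasure P X = emeasure Q X"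
      using eq[of a b] by (simp add: P.emeasure_eq_measure Q.emeasure_eq_measure atMost_pair)
  next
    show "(\<Union>i. {..(real i, real i)}) = UNIV"
    proof (intro equalityI subset_UNIV subsetI)
      fix p :: "real \<times> real"
      obtain n :: nat where "max (fst p) (snd p) \<le> n" using real_arch_simple by blast
      then show "p \<in> (\<Union>i. {..(real i, real i)})" by (auto simp: less_eq_prod_def intro!: exI[of _ n])
    qed
  qed (use assms gen in auto)
qed

text \<open>
  A bivariate copula \<open>D\<close> together with the probability measure \<open>Q\<close> whose distribution function it is. Outside
  the unit square \<open>D\<close> is unconstrained.
\<close>
locale bivariate_copula = prob_space Q for Q :: "(real \<times> real) measure" +
  fixes D :: "real \<Rightarrow> real \<Rightarrow> real"
  assumes sets_Q: "sets Q = sets borel"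
    and margin1: "distr Q borel fst = unit_uniform"
    and margin2: "distr Q borel snd = unit_uniform"
    and D: "\<lbrakk>0 \<le> u; u \<le> 1; 0 \<le> v; v \<le> 1\<rbrakk> \<Longrightarrow> D u v = measure Q ({..u} \<times> {..v})"
begin

lemma sets_Q_pair [measurable_cong]: "sets Q = sets (borel \<Otimes>\<^sub>M borel)"
  by (simp only: sets_Q borel_prod)

lemma space_Q [simp]: "space Q = UNIV"
  using sets_eq_imp_space_eq[OF sets_Q] by simp

lemma AE_unit: "AE p in Q. 0 \<le> fst p \<and> fst p \<le> 1 \<and> 0 \<le> snd p \<and> snd p \<le> 1"
proof -
  have "AE p in Q. 0 \<le> fst p \<and> fst p \<le> 1"
    using AE_unit_uniform unfolding margin1[symmetric] by (subst (asm) AE_distr_iff) auto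
  moreover have "AE p in Q. 0 \<le> snd p \<and> snd p \<le> 1"
    using AE_unit_uniform unfolding margin2[symmetric] by (subst (asm) AE_distr_iff) auto
  ultimately show ?thesis by eventually_elim auto
qed

lemma D_margins:
  assumes "0 \<le> t" "t \<le> 1"
  shows "D t 1 = t" "D 1 t = t"
proof -
  have [measurable]: "fst -` {..t} \<in> events" "snd -` {..t} \<in> events"
    using measurable_sets[of fst Q borel "{..t}"] measurable_sets[of snd Q borel "{..t}"] by auto
  have "D t 1 = prob (fst -` {..t} \<inter> space Q)"
    using assms by (subst D) (auto intro!: finite_measure_eq_AE eventually_mono[OF AE_unit])
  also have "\<dots> = measure unit_uniform {..t}"
    unfolding margin1[symmetric] by (rule measure_distr[symmetric]) auto
  finally show "D t 1 = t" using assms by (simp add: measure_unit_uniform_atMost)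
  have "D 1 t = prob (snd -` {..t} \<inter> space Q)"
    using assms by (subst D) (auto intro!: finite_measure_eq_AE eventually_mono[OF AE_unit])
  also have "\<dots> = measure unit_uniform {..t}"
    unfolding margin2[symmetric] by (rule measure_distr[symmetric]) auto
  finally show "D 1 t = t" using assms by (simp add: measure_unit_uniform_atMost)
qed

lemma D_zero:
  assumes "0 \<le> t" "t \<le> 1"
  shows "D t 0 = 0" "D 0 t = 0"
proof -
  have "D t 0 \<le> D 1 0" "D 0 t \<le> D 0 1"
    using assms by (auto simp: D intro!: finite_measure_mono)
  moreover have "D t 0 \<ge> 0" "D 0 t \<ge> 0"
    using assms by (auto simp: D)
  ultimately show "D t 0 = 0" "D 0 t = 0"
    using D_margins[of 0] by auto
qed

text \<open>
  A probability measure that agrees with \<open>D\<close> on the unit square is concentrated there, because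
  \<open>D 1 1 = 1\<close>, \<open>D 0 1 = 0\<close> and \<open>D 1 0 = 0\<close>. So its distribution function is determined everywhere by \<open>D\<close>.
\<close>
lemma measure_eq_clamped:
  assumes "prob_space P" "sets P = sets borel"
    and P: "\<forall>u\<in>{0..1}. \<forall>v\<in>{0..1}. measure P ({..u} \<times> {..v}) = D u v"
  shows "measure P ({..a} \<times> {..b}) = D (max 0 (min 1 a)) (max 0 (min 1 b))"
proof -
  interpret P: prob_space P by fact
  have [measurable_cong]: "sets P = sets (borel \<Otimes>\<^sub>M borel)"
    by (simp only: assms borel_prod)
  have "P.prob ({..1} \<times> {..1}) = 1" "P.prob ({..0} \<times> {..1}) = 0" "P.prob ({..1} \<times> {..0}) = 0"
    using P D_margins[of 1] D_margins[of 0] by auto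
  then have "AE p in P. p \<in> {..1} \<times> {..1}" "AE p in P. p \<notin> {..0} \<times> {..1}" "AE p in P. p \<notin> {..1} \<times> {..0}"
    by (auto simp: P.prob_eq_1 P.prob_eq_0)
  then have "AE p in P. p \<in> {..a} \<times> {..b} \<longleftrightarrow> p \<in> {..max 0 (min 1 a)} \<times> {..max 0 (min 1 b)}"
    by eventually_elim (auto simp: max_def min_def)
  then have "measure P ({..a} \<times> {..b}) = measure P ({..max 0 (min 1 a)} \<times> {..max 0 (min 1 b)})"
    by (intro P.finite_measure_eq_AE) auto
  then show ?thesis using P by simp
qed

lemma copula_measure_eq: "copula_measure D = Q"
  unfolding copula_measure_def
proof (rule the_equality)
  show Q: "prob_space Q \<and> sets Q = sets borel \<and> (\<forall>u\<in>{0..1}. \<forall>v\<in>{0..1}. prob ({..u} \<times> {..v}) = D u v)"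
    using sets_Q D prob_space_axioms by auto
  fix P :: "(real \<times> real) measure"
  assume "prob_space P \<and> sets P = sets borel \<and>
    (\<forall>u\<in>{0..1}. \<forall>v\<in>{0..1}. measure P ({..u} \<times> {..v}) = D u v)"
  with Q show "P = Q"
    by (intro borel_prod_measure_eqI) (auto simp: measure_eq_clamped)
qed

text \<open>
  The distribution function of \<open>Q\<close> on the whole plane. Written as an integral it is measurable in both
  arguments and accessible to Fubini's theorem.
\<close>
definition joint_cdf :: "real \<Rightarrow> real \<Rightarrow> real" where
  "joint_cdf u v = (\<integral>p. indicator {..u} (fst p) * indicator {..v} (snd p) \<partial>Q)"

lemma joint_cdf_eq: "joint_cdf u v = measure Q ({..u} \<times> {..v})"
proof -
  have "joint_cdf u v = (\<integral>p. indicator ({..u} \<times> {..v}) p \<partial>Q)"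
    unfolding joint_cdf_def by (intro Bochner_Integration.integral_cong) (auto simp: indicator_def)
  then show ?thesis by simp
qed

lemma D_eq_joint_cdf: "u \<in> {0..1} \<Longrightarrow> v \<in> {0..1} \<Longrightarrow> D u v = joint_cdf u v"
  by (simp add: D joint_cdf_eq)

lemma joint_cdf_measurable: "(\<lambda>p. joint_cdf (fst p) (snd p)) \<in> borel_measurable (borel \<Otimes>\<^sub>M borel)"
proof -
  have "(\<lambda>p. \<integral>q. (if fst q \<le> fst p then 1 else 0) * (if snd q \<le> snd p then 1 else 0 :: real) \<partial>Q)
      \<in> borel_measurable (borel \<Otimes>\<^sub>M borel)"
    by measurable
  then show ?thesis
    by (simp add: joint_cdf_def indicator_def of_bool_def)
qed

lemma joint_cdf_measurable' [measurable (raw)]: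
  assumes [measurable]: "f \<in> borel_measurable N" "g \<in> borel_measurable N"
  shows "(\<lambda>x. joint_cdf (f x) (g x)) \<in> borel_measurable N"
proof -
  have "(\<lambda>x. (f x, g x)) \<in> measurable N (borel \<Otimes>\<^sub>M borel)" by measurable
  from measurable_compose[OF this joint_cdf_measurable] show ?thesis by simp
qed

lemma joint_cdf_bounds: "0 \<le> joint_cdf u v" "joint_cdf u v \<le> 1"
  by (auto simp: joint_cdf_eq)

lemma iterated_integral_eq:
  "(LBINT v:{0..1}. (LBINT u:{0..1}. D u v)) = (\<integral>v. (\<integral>u. joint_cdf u v \<partial>unit_uniform) \<partial>unit_uniform)"
proof -
  have "(LBINT v:{0..1}. (LBINT u:{0..1}. D u v)) = (LBINT v:{0..1}. (LBINT u:{0..1}. joint_cdf u v))"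
    by (intro set_lebesgue_integral_cong) (auto intro!: set_lebesgue_integral_cong simp: D_eq_joint_cdf)
  also have "\<dots> = (LBINT v:{0..1}. (\<integral>u. joint_cdf u v \<partial>unit_uniform))"
    by (simp add: integral_unit_uniform)
  also have "\<dots> = (\<integral>v. (\<integral>u. joint_cdf u v \<partial>unit_uniform) \<partial>unit_uniform)"
  proof (rule integral_unit_uniform)
    interpret U: prob_space unit_uniform by (rule prob_space_unit_uniform)
    show "(\<lambda>v. \<integral>u. joint_cdf u v \<partial>unit_uniform) \<in> borel_measurable borel" by measurable
  qed
  finally show ?thesis .
qed

lemma integral_unit_uniform_indicator:
  "x \<in> {0..1} \<Longrightarrow> (\<integral>u. indicator {..u} x \<partial>unit_uniform) = 1 - x"
proof -
  assume "x \<in> {0..1}"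
  have "(\<integral>u. indicator {..u} x \<partial>unit_uniform) = (\<integral>u. indicator {x..} u \<partial>unit_uniform)"
    by (intro Bochner_Integration.integral_cong) (auto simp: indicator_def)
  also have "\<dots> = 1 - x" using \<open>x \<in> {0..1}\<close> by (simp add: measure_unit_uniform_atLeast)
  finally show ?thesis .
qed

lemma integrable_fst_snd:
  "integrable Q fst" "integrable Q snd" "integrable Q (\<lambda>p. fst p * snd p)"
proof -
  show "integrable Q fst"
    by (intro integrable_const_bound[where B = 1]) (auto intro!: eventually_mono[OF AE_unit])
  show "integrable Q snd"
    by (intro integrable_const_bound[where B = 1]) (auto intro!: eventually_mono[OF AE_unit])
  show "integrable Q (\<lambda>p. fst p * snd p)"
    by (intro integrable_const_bound[where B = 1])
      (auto intro!: eventually_mono[OF AE_unit] simp: abs_mult intro: mult_le_one)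
qed

lemma expectation_fst_snd: "expectation fst = 1 / 2" "expectation snd = 1 / 2"
proof -
  have "expectation fst = (\<integral>x. x \<partial>distr Q borel fst)" by (subst integral_distr) auto
  then show "expectation fst = 1 / 2" by (simp add: margin1 integral_ident_unit_uniform)
  have "expectation snd = (\<integral>x. x \<partial>distr Q borel snd)" by (subst integral_distr) auto
  then show "expectation snd = 1 / 2" by (simp add: margin2 integral_ident_unit_uniform)
qed

text \<open>
  Hoeffding's identity. Integrating the indicator of \<open>x \<le> u \<and> y \<le> v\<close> over \<open>u\<close> and \<open>v\<close> gives
  \<open>(1 - x) * (1 - y)\<close>, and both margins have mean \<open>1 / 2\<close>, so exchanging the integrals with the
  expectation leaves just the mean of \<open>x * y\<close>.
\<close>
lemma integral_joint_cdf:
  "(\<integral>v. (\<integral>u. joint_cdf u v \<partial>unit_uniform) \<partial>unit_uniform) = expectation (\<lambda>p. fst p * snd p)"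
proof -
  interpret U: prob_space unit_uniform by (rule prob_space_unit_uniform)
  interpret UQ: pair_prob_space unit_uniform Q ..
  have ind: "(\<lambda>p. indicator {..f p} (g p) :: real) \<in> borel_measurable N"
    if [measurable]: "f \<in> borel_measurable N" "g \<in> borel_measurable N" for f g :: "_ \<Rightarrow> real" and N
    unfolding indicator_def of_bool_def atMost_iff by measurable
  note ind[measurable (raw)]
  have "(\<integral>u. joint_cdf u v \<partial>unit_uniform) = (\<integral>p. (1 - fst p) * indicator {..v} (snd p) \<partial>Q)" for v
  proof -
    have "integrable (unit_uniform \<Otimes>\<^sub>M Q) (\<lambda>(u, p). indicator {..u} (fst p) * indicator {..v} (snd p) :: real)"
      by (intro UQ.integrable_const_bound[where B = 1]) (auto simp: indicator_def)
    from UQ.Fubini_integral[OF this]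
    have "(\<integral>u. joint_cdf u v \<partial>unit_uniform) =
        (\<integral>p. (\<integral>u. indicator {..u} (fst p) * indicator {..v} (snd p) \<partial>unit_uniform) \<partial>Q)"
      by (simp add: joint_cdf_def)
    also have "\<dots> = (\<integral>p. (1 - fst p) * indicator {..v} (snd p) \<partial>Q)"
      by (intro integral_cong_AE) (auto intro!: eventually_mono[OF AE_unit] simp: integral_unit_uniform_indicator)
    finally show ?thesis .
  qed
  then have "(\<integral>v. (\<integral>u. joint_cdf u v \<partial>unit_uniform) \<partial>unit_uniform) =
      (\<integral>v. (\<integral>p. (1 - fst p) * indicator {..v} (snd p) \<partial>Q) \<partial>unit_uniform)"
    by simp
  also have "\<dots> = (\<integral>p. (\<integral>v. (1 - fst p) * indicator {..v} (snd p) \<partial>unit_uniform) \<partial>Q)"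
  proof -
    have "AE p in Q. \<bar>1 - fst p\<bar> \<le> 1" using AE_unit by eventually_elim auto
    then have "AE x in unit_uniform \<Otimes>\<^sub>M Q. norm ((\<lambda>(v, p). (1 - fst p) * indicator {..v} (snd p) :: real) x) \<le> 1"
    proof (intro UQ.AE_pair_measure)
      show "{x \<in> space (unit_uniform \<Otimes>\<^sub>M Q).
          norm ((\<lambda>(v, p). (1 - fst p) * indicator {..v} (snd p) :: real) x) \<le> 1} \<in> sets (unit_uniform \<Otimes>\<^sub>M Q)"
        by measurable
    qed (auto elim!: eventually_mono simp: indicator_def)
    then have "integrable (unit_uniform \<Otimes>\<^sub>M Q) (\<lambda>(v, p). (1 - fst p) * indicator {..v} (snd p) :: real)"
      by (intro UQ.integrable_const_bound[where B = 1]) auto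
    from UQ.Fubini_integral[OF this] show ?thesis by simp
  qed
  also have "\<dots> = (\<integral>p. (1 - fst p) * (1 - snd p) \<partial>Q)"
    by (intro integral_cong_AE) (auto intro!: eventually_mono[OF AE_unit] simp: integral_unit_uniform_indicator)
  also have "\<dots> = (\<integral>p. 1 - fst p - snd p + fst p * snd p \<partial>Q)"
    by (simp add: algebra_simps)
  also have "\<dots> = expectation (\<lambda>p. fst p * snd p)"
    using integrable_fst_snd expectation_fst_snd prob_space[unfolded space_Q] by simp
  finally show ?thesis .
qed

text \<open>
  Both measures of association vanish for the independence copula \<open>u * v\<close> and depend continuously on the
  copula in the supremum norm. For Spearman's rho this is immediate. Kendall's tau involves the copula twice:
  replacing the integrand by \<open>u * v\<close> costs an error \<open>e\<close>, and by Hoeffding's identity the remaining mean of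
  \<open>u * v\<close> is an integral of the copula against Lebesgue measure, whose replacement costs another \<open>e\<close>.
\<close>
context
  fixes e :: real
  assumes close: "\<And>u v. u \<in> {0..1} \<Longrightarrow> v \<in> {0..1} \<Longrightarrow> \<bar>D u v - u * v\<bar> \<le> e"
begin

lemma expectation_prod_near: "\<bar>expectation (\<lambda>p. fst p * snd p) - 1 / 4\<bar> \<le> e"
proof -
  interpret U: prob_space unit_uniform by (rule prob_space_unit_uniform)
  have int_id: "integrable unit_uniform (\<lambda>x. x)"
    by (intro U.integrable_const_bound[where B = 1]) (auto intro!: eventually_mono[OF AE_unit_uniform])
  have int_cdf: "integrable unit_uniform (\<lambda>u. joint_cdf u v)" for v
    using joint_cdf_bounds by (intro U.integrable_const_bound[where B = 1]) auto
  have meas: "(\<lambda>v. \<integral>u. joint_cdf u v \<partial>unit_uniform) \<in> borel_measurable borel" by measurable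
  have inner: "\<bar>(\<integral>u. joint_cdf u v \<partial>unit_uniform) - v / 2\<bar> \<le> e" if "v \<in> {0..1}" for v
  proof -
    have "\<bar>(\<integral>u. joint_cdf u v \<partial>unit_uniform) - (\<integral>u. u * v \<partial>unit_uniform)\<bar> \<le> e"
      using int_id int_cdf close that
      by (intro U.abs_integral_diff_le) (auto intro!: eventually_mono[OF AE_unit_uniform] simp flip: D_eq_joint_cdf)
    then show ?thesis by (simp add: integral_ident_unit_uniform)
  qed
  have int_inner: "integrable unit_uniform (\<lambda>v. \<integral>u. joint_cdf u v \<partial>unit_uniform)"
  proof (rule U.integrable_const_bound[where B = 1])
    show "AE v in unit_uniform. norm (\<integral>u. joint_cdf u v \<partial>unit_uniform) \<le> 1"
    proof (intro AE_I2)
      fix v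
      have "\<bar>\<integral>u. joint_cdf u v \<partial>unit_uniform\<bar> \<le> (\<integral>u. 1 \<partial>unit_uniform)"
        using joint_cdf_bounds int_cdf
        by (intro order_trans[OF integral_abs_bound] integral_mono) auto
      then show "norm (\<integral>u. joint_cdf u v \<partial>unit_uniform) \<le> 1" using U.prob_space by simp
    qed
  qed (use meas in simp)
  have "\<bar>(\<integral>v. (\<integral>u. joint_cdf u v \<partial>unit_uniform) \<partial>unit_uniform) - (\<integral>v. v / 2 \<partial>unit_uniform)\<bar> \<le> e"
    using inner int_id int_inner
    by (intro U.abs_integral_diff_le) (auto intro!: eventually_mono[OF AE_unit_uniform])
  then show ?thesis by (simp add: integral_joint_cdf integral_ident_unit_uniform)
qed

lemma spearman_rho_le: "\<bar>spearman_rho D\<bar> \<le> 12 * e"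
  using expectation_prod_near
  unfolding spearman_rho_def iterated_integral_eq integral_joint_cdf by linarith

lemma kendall_tau_le: "\<bar>kendall_tau D\<bar> \<le> 8 * e"
proof -
  have "(LINT p:{0..1} \<times> {0..1}|Q. D (fst p) (snd p)) =
      (\<integral>p. indicator ({0..1} \<times> {0..1}) p * joint_cdf (fst p) (snd p) \<partial>Q)"
    unfolding set_lebesgue_integral_def
    by (intro Bochner_Integration.integral_cong) (auto simp: indicator_def D_eq_joint_cdf)
  also have "\<dots> = (\<integral>p. joint_cdf (fst p) (snd p) \<partial>Q)"
    by (intro integral_cong_AE) (auto intro!: eventually_mono[OF AE_unit] simp: indicator_def mem_Times_iff)
  finally have eq: "(LINT p:{0..1} \<times> {0..1}|Q. D (fst p) (snd p)) = (\<integral>p. joint_cdf (fst p) (snd p) \<partial>Q)" .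
  have "\<bar>(\<integral>p. joint_cdf (fst p) (snd p) \<partial>Q) - expectation (\<lambda>p. fst p * snd p)\<bar> \<le> e"
  proof (rule abs_integral_diff_le)
    show "integrable Q (\<lambda>p. joint_cdf (fst p) (snd p))"
      using joint_cdf_bounds by (intro integrable_const_bound[where B = 1]) auto
    show "AE p in Q. \<bar>joint_cdf (fst p) (snd p) - fst p * snd p\<bar> \<le> e"
      using close by (auto intro!: eventually_mono[OF AE_unit] simp flip: D_eq_joint_cdf)
  qed (rule integrable_fst_snd)
  then show ?thesis
    using expectation_prod_near unfolding kendall_tau_def copula_measure_eq eq by linarith
qed

end

end

section \<open>The copula of the first and the last margin\<close>

text \<open>
  Sklar's identity for the pair of the first and the last margin. A finite point \<open>x\<close> of the \<open>K\<close>-dimensional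
  identity need not have \<open>F i (x i) = 1\<close> at the middle coordinates, so they are sent to infinity. On the side
  of the copula the limit is controlled by the uniform margins: restricting coordinate \<open>i\<close> to values at most
  \<open>F i n\<close> removes mass \<open>1 - F i n\<close>.
\<close>
lemma first_last_margin_bivariate_copula:
  assumes "K \<ge> 2" "prob_space M" "sets M = sets (PiM {1..K} (\<lambda>_. borel :: real measure))"
    and C: "is_copula_of K C M"
  obtains Q where "bivariate_copula Q (first_last_margin K C)"
    and "\<And>a b. measure M {y \<in> space M. y 1 \<le> a \<and> y K \<le> b} =
      first_last_margin K C (cdf (distr M borel (\<lambda>y. y 1)) a) (cdf (distr M borel (\<lambda>y. y K)) b)"
proof -
  interpret M: prob_space M by fact
  obtain P where P: "prob_space P" "sets P = sets (PiM {1..K} (\<lambda>_. borel :: real measure))"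
      "\<And>i. i \<in> {1..K} \<Longrightarrow> distr P borel (\<lambda>x. x i) = unit_uniform"
      "\<And>u. u \<in> {1..K} \<rightarrow>\<^sub>E {0..1} \<Longrightarrow> C u = measure P {x \<in> space P. \<forall>i\<in>{1..K}. x i \<le> u i}"
    using C unfolding is_copula_of_def is_copula_def by blast
  interpret P: prob_space P by fact
  have mP [measurable]: "(\<lambda>x. x i) \<in> borel_measurable P" if "i \<in> {1..K}" for i
    using measurable_component_singleton[OF that, of "\<lambda>_. borel :: real measure"]
    by (simp add: measurable_cong_sets[OF P(2) refl])
  have mM [measurable]: "(\<lambda>x. x i) \<in> borel_measurable M" if "i \<in> {1..K}" for i
    using measurable_component_singleton[OF that, of "\<lambda>_. borel :: real measure"]
    by (simp add: measurable_cong_sets[OF assms(3) refl])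
  have ends: "1 \<in> {1..K}" "K \<in> {1..K}" "K \<noteq> 1" using \<open>K \<ge> 2\<close> by auto
  note mP_ends [measurable] = mP[OF ends(1)] mP[OF ends(2)]
  have level_P: "{x \<in> space P. x i \<le> t} \<in> P.events" if "i \<in> {1..K}" for i t
    using mP[OF that] by (simp only: borel_measurable_iff_le)
  have level_M: "{y \<in> space M. y i \<le> t} \<in> M.events" if "i \<in> {1..K}" for i t
    using mM[OF that] by (simp only: borel_measurable_iff_le)
  have AE_P: "AE x in P. 0 \<le> x i \<and> x i \<le> 1" if "i \<in> {1..K}" for i
    using AE_unit_uniform mP[OF that] unfolding P(3)[OF that, symmetric]
    by (subst (asm) AE_distr_iff) auto
  have P_le: "measure P {x \<in> space P. x i \<le> u} = u" if "i \<in> {1..K}" "0 \<le> u" "u \<le> 1" for i u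
  proof -
    have "measure P {x \<in> space P. x i \<le> u} = measure (distr P borel (\<lambda>x. x i)) {..u}"
      using mP[OF that(1)] by (subst measure_distr) (auto intro!: arg_cong[where f = "measure P"])
    then show ?thesis using that by (simp add: P(3) measure_unit_uniform_atMost)
  qed
  let ?D = "first_last_margin K C"
  have D_eq: "?D u v = measure P {x \<in> space P. x 1 \<le> u \<and> x K \<le> v}"
    if "u \<in> {0..1}" "v \<in> {0..1}" for u v
  proof -
    let ?u = "\<lambda>i\<in>{1..K}. if i = 1 then u else if i = K then v else 1"
    have "?D u v = measure P {x \<in> space P. \<forall>i\<in>{1..K}. x i \<le> ?u i}"
      unfolding first_last_margin_def using that by (intro P(4)) auto
    also have "\<dots> = measure P {x \<in> space P. x 1 \<le> u \<and> x K \<le> v}"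
    proof (rule P.finite_measure_eq_AE)
      have "AE x in P. \<forall>i\<in>{1..K}. x i \<le> 1"
        using AE_P by (intro AE_finite_allI) (auto elim!: eventually_mono)
      then show "AE x in P. x \<in> {x \<in> space P. \<forall>i\<in>{1..K}. x i \<le> ?u i} \<longleftrightarrow>
          x \<in> {x \<in> space P. x 1 \<le> u \<and> x K \<le> v}"
      proof eventually_elim
        case (elim x)
        then have "(\<forall>i\<in>{1..K}. x i \<le> ?u i) \<longleftrightarrow> x 1 \<le> u \<and> x K \<le> v"
          using ends by fastforce
        then show ?case by simp
      qed
      show "{x \<in> space P. \<forall>i\<in>{1..K}. x i \<le> ?u i} \<in> P.events"
        by (intro sets.sets_Collect_finite_All level_P) auto
    qed measurable
    finally show ?thesis .
  qed
  define Q where "Q = distr P borel (\<lambda>x. (x 1, x K))"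
  have mpair [measurable]: "(\<lambda>x. (x 1, x K)) \<in> measurable P borel"
    by (intro borel_measurable_Pair mP_ends)
  have projections: "fst \<in> borel_measurable (borel :: (real \<times> real) measure)"
      "snd \<in> borel_measurable (borel :: (real \<times> real) measure)"
    by (simp_all flip: borel_prod)
  have "bivariate_copula Q ?D"
  proof (intro bivariate_copula.intro bivariate_copula_axioms.intro)
    show "prob_space Q" unfolding Q_def by (rule P.prob_space_distr) (rule mpair)
    show "sets Q = sets borel" by (simp add: Q_def)
    show "distr Q borel fst = unit_uniform"
      unfolding Q_def P(3)[OF ends(1), symmetric]
      by (subst distr_distr[OF _ mpair]) (simp_all add: projections comp_def)
    show "distr Q borel snd = unit_uniform"
      unfolding Q_def P(3)[OF ends(2), symmetric]
      by (subst distr_distr[OF _ mpair]) (simp_all add: projections comp_def)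
    fix u v :: real assume "0 \<le> u" "u \<le> 1" "0 \<le> v" "v \<le> 1"
    moreover have "measure Q ({..u} \<times> {..v}) = measure P ((\<lambda>x. (x 1, x K)) -` ({..u} \<times> {..v}) \<inter> space P)"
      unfolding Q_def by (rule measure_distr[OF mpair]) (simp add: atMost_pair)
    moreover have "(\<lambda>x. (x 1, x K)) -` ({..u} \<times> {..v}) \<inter> space P = {x \<in> space P. x 1 \<le> u \<and> x K \<le> v}"
      by auto
    ultimately show "?D u v = measure Q ({..u} \<times> {..v})"
      by (simp add: D_eq)
  qed
  moreover have "measure M {y \<in> space M. y 1 \<le> a \<and> y K \<le> b} =
      ?D (cdf (distr M borel (\<lambda>y. y 1)) a) (cdf (distr M borel (\<lambda>y. y K)) b)" for a b
  proof -
    define F where "F i = cdf (distr M borel (\<lambda>y. y i))" for i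
    define x :: "nat \<Rightarrow> nat \<Rightarrow> real" where
      "x n = (\<lambda>i\<in>{1..K}. if i = 1 then a else if i = K then b else real n)" for n
    have F_unit: "F i t \<in> {0..1}" if "i \<in> {1..K}" for i t
    proof -
      interpret d: prob_space "distr M borel (\<lambda>y. y i)"
        by (rule M.prob_space_distr[OF mM[OF that]])
      show ?thesis by (simp add: F_def cdf_def)
    qed
    let ?A = "\<lambda>n. {y \<in> space M. \<forall>i\<in>{1..K}. y i \<le> x n i}"
    let ?B = "\<lambda>n. {z \<in> space P. \<forall>i\<in>{1..K}. z i \<le> F i (x n i)}"
    let ?E = "{z \<in> space P. z 1 \<le> F 1 a \<and> z K \<le> F K b}"
    have sklar: "measure M (?A n) = measure P (?B n)" for n
    proof -
      have "x n \<in> {1..K} \<rightarrow>\<^sub>E UNIV" by (simp add: x_def)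
      then have "measure M (?A n) = C (\<lambda>i\<in>{1..K}. F i (x n i))"
        using C unfolding is_copula_of_def F_def by blast
      also have "\<dots> = measure P {z \<in> space P. \<forall>i\<in>{1..K}. z i \<le> (\<lambda>i\<in>{1..K}. F i (x n i)) i}"
        using F_unit by (intro P(4)) auto
      finally show ?thesis by simp
    qed
    have "(\<lambda>n. measure M (?A n)) \<longlonglongrightarrow> measure M (\<Union>n. ?A n)"
    proof (rule M.finite_Lim_measure_incseq)
      show "range ?A \<subseteq> M.events"
        by (intro image_subsetI sets.sets_Collect_finite_All level_M) auto
      have "x m i \<le> x n i" if "m \<le> n" "i \<in> {1..K}" for m n i
        using that by (simp add: x_def)
      then show "incseq ?A"
        by (auto simp only: incseq_def intro: order_trans)
    qed
    also have "(\<Union>n. ?A n) = {y \<in> space M. y 1 \<le> a \<and> y K \<le> b}"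
    proof safe
      fix y assume y: "y \<in> space M" "y 1 \<le> a" "y K \<le> b"
      obtain n :: nat where n: "Max (y ` {1..K}) \<le> real n" using real_arch_simple by blast
      have "y i \<le> x n i" if "i \<in> {1..K}" for i
      proof -
        have "y i \<le> Max (y ` {1..K})" using that by (intro Max_ge) auto
        then show ?thesis using n that y by (auto simp: x_def)
      qed
      then show "y \<in> (\<Union>n. ?A n)" using y(1) by blast
    next
      fix n y assume *: "\<forall>i\<in>{1..K}. y i \<le> x n i"
      show "y 1 \<le> a" "y K \<le> b"
        using bspec[OF * ends(1)] bspec[OF * ends(2)] ends by (simp_all add: x_def)
    qed
    finally have lim1: "(\<lambda>n. measure P (?B n)) \<longlonglongrightarrow> measure M {y \<in> space M. y 1 \<le> a \<and> y K \<le> b}"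
      by (simp only: sklar)
    have B_le: "measure P (?B n) \<le> measure P ?E" for n
    proof (rule P.finite_measure_mono)
      show "?B n \<subseteq> ?E"
      proof safe
        fix z assume *: "\<forall>i\<in>{1..K}. z i \<le> F i (x n i)"
        show "z 1 \<le> F 1 a" "z K \<le> F K b"
          using bspec[OF * ends(1)] bspec[OF * ends(2)] ends by (simp_all add: x_def)
      qed
      show "?E \<in> P.events" by measurable
    qed
    have B_ge: "measure P ?E - (\<Sum>i\<in>{1<..<K}. 1 - F i (real n)) \<le> measure P (?B n)" for n
    proof -
      let ?N = "\<lambda>i. {z \<in> space P. \<not> z i \<le> F i (real n)}"
      have N: "measure P (?N i) = 1 - F i (real n)" if "i \<in> {1<..<K}" for i
      proof -
        have i: "i \<in> {1..K}" using that by auto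
        show ?thesis
          using P.prob_neg[of "\<lambda>z. z i \<le> F i (real n)"] P_le[OF i] F_unit[OF i] mP[OF i] by simp
      qed
      have meas: "?N i \<in> P.events" if "i \<in> {1<..<K}" for i
      proof -
        have i: "i \<in> {1..K}" using that by auto
        note mP[OF i, measurable]
        show ?thesis by measurable
      qed
      have meas_B: "?B n \<in> P.events"
        by (intro sets.sets_Collect_finite_All level_P) auto
      have "?E \<subseteq> ?B n \<union> (\<Union>i\<in>{1<..<K}. ?N i)"
      proof
        fix z assume z: "z \<in> ?E"
        show "z \<in> ?B n \<union> (\<Union>i\<in>{1<..<K}. ?N i)"
        proof (cases "\<exists>i\<in>{1<..<K}. z \<in> ?N i")
          case False
          have "z i \<le> F i (x n i)" if i: "i \<in> {1..K}" for i
          proof -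
            consider "i = 1" | "i = K" | "i \<in> {1<..<K}" using i by force
            then show ?thesis using z ends False by cases (auto simp: x_def)
          qed
          then show ?thesis using z by blast
        qed blast
      qed
      then have "measure P ?E \<le> measure P (?B n \<union> (\<Union>i\<in>{1<..<K}. ?N i))"
        using meas meas_B by (intro P.finite_measure_mono) auto
      also have "\<dots> \<le> measure P (?B n) + measure P (\<Union>i\<in>{1<..<K}. ?N i)"
        using meas meas_B by (intro measure_Un_le) auto
      also have "measure P (\<Union>i\<in>{1<..<K}. ?N i) \<le> (\<Sum>i\<in>{1<..<K}. measure P (?N i))"
        using meas by (intro P.finite_measure_subadditive_finite) auto
      finally show ?thesis using N by simp
    qed
    have "(\<lambda>n. F i (real n)) \<longlonglongrightarrow> 1" if "i \<in> {1..K}" for i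
    proof -
      interpret d: real_distribution "distr M borel (\<lambda>y. y i)"
        by (intro M.real_distribution_distr mM that)
      show ?thesis unfolding F_def
        by (rule filterlim_compose[OF d.cdf_lim_at_top_prob filterlim_real_sequentially])
    qed
    then have "(\<lambda>n. measure P ?E - (\<Sum>i\<in>{1<..<K}. 1 - F i (real n))) \<longlonglongrightarrow>
        measure P ?E - (\<Sum>i\<in>{1<..<K}. 1 - 1)"
      by (intro tendsto_intros) auto
    then have lower: "(\<lambda>n. measure P ?E - (\<Sum>i\<in>{1<..<K}. 1 - F i (real n))) \<longlonglongrightarrow> measure P ?E"
      by simp
    have "(\<lambda>n. measure P (?B n)) \<longlonglongrightarrow> measure P ?E"
      by (rule real_tendsto_sandwich[OF always_eventually always_eventually lower tendsto_const])
        (rule allI, rule B_ge, rule allI, rule B_le)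
    then have "measure M {y \<in> space M. y 1 \<le> a \<and> y K \<le> b} = measure P ?E"
      by (rule LIMSEQ_unique[OF lim1])
    then show ?thesis
      using D_eq[OF F_unit[OF ends(1), of a] F_unit[OF ends(2), of b]] by (simp add: F_def)
  qed
  ultimately show ?thesis by (rule that)
qed

text \<open>
  An interior point \<open>(u, v)\<close> of the unit square is \<open>(exp (- r), P (T\<^sub>K \<ge> s))\<close> for some \<open>r, s > 0\<close>. As \<open>\<Lambda>\<close> is
  decreasing and onto, these are the marginal distribution functions at some \<open>a\<close> and \<open>b\<close>, and Sklar's identity
  makes the copula at \<open>(u, v)\<close> equal to the joint tail of \<open>T\<^sub>1\<close> and \<open>T\<^sub>K\<close>.
\<close>
lemma (in mgev_params) first_last_margin_near_independence:
  assumes "K \<ge> 2" "is_copula_of K C (mgev K \<mu> \<sigma> \<xi>)"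
  obtains Q where "bivariate_copula Q (first_last_margin K C)"
    and "\<And>u v. u \<in> {0..1} \<Longrightarrow> v \<in> {0..1} \<Longrightarrow> \<bar>first_last_margin K C u v - u * v\<bar> \<le> poisson_peak (K - 1)"
proof -
  let ?M = "mgev K \<mu> \<sigma> \<xi>" and ?D = "first_last_margin K C"
  interpret M: prob_space ?M using assms by (intro prob_space_mgev) auto
  obtain Q where Q: "bivariate_copula Q ?D"
    and joint: "\<And>a b. measure ?M {y \<in> space ?M. y 1 \<le> a \<and> y K \<le> b} =
      ?D (cdf (distr ?M borel (\<lambda>y. y 1)) a) (cdf (distr ?M borel (\<lambda>y. y K)) b)"
    by (rule first_last_margin_bivariate_copula[OF assms(1) M.prob_space_axioms sets_mgev assms(2)])
      (rule that)
  interpret Q: bivariate_copula Q ?D by fact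
  have cdf: "cdf (distr ?M borel (\<lambda>y. y i)) a = measure ?M {y \<in> space ?M. y i \<le> a}" if "i \<in> {1..K}" for i a
  proof -
    have "(\<lambda>y. y i) \<in> borel_measurable ?M"
      using measurable_component_singleton[OF that, of "\<lambda>_. borel :: real measure"]
      by (simp add: measurable_cong_sets[OF sets_mgev refl])
    then show ?thesis
      unfolding cdf_def by (subst measure_distr) (auto intro!: arg_cong[where f = "measure ?M"])
  qed
  have le_iff: "w \<le> a \<longleftrightarrow> \<Lambda> a \<le> \<Lambda> w" if "w \<in> supp" "a \<in> supp" for w a
    using \<Lambda>_less_iff[OF that(2,1)] by (simp flip: not_less)
  have "\<bar>?D u v - u * v\<bar> \<le> poisson_peak (K - 1)" if uv: "u \<in> {0..1}" "v \<in> {0..1}" for u v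
  proof (cases "u \<in> {0<..<1} \<and> v \<in> {0<..<1}")
    case False
    then consider "u = 0" | "u = 1" | "v = 0" | "v = 1" using uv by fastforce
    then have "?D u v = u * v"
      using uv by cases (simp_all add: Q.D_zero Q.D_margins)
    then show ?thesis by (simp add: poisson_peak_nonneg)
  next
    case True
    define r where "r = - ln u"
    have r: "r > 0" "exp (- r) = u" using True by (auto simp: r_def)
    obtain s where s: "s > 0" "arrival_tail K s 0 = v"
      using arrival_tail_origin_onto[of K v] True assms(1) by auto
    obtain a where a: "a \<in> supp" "\<Lambda> a = r" using \<Lambda>_onto r by blast
    obtain b where b: "b \<in> supp" "\<Lambda> b = s" using \<Lambda>_onto s by blast
    have K: "K \<ge> 1" using assms(1) by simp
    have in_a: "w \<in> {..a} \<longleftrightarrow> r \<le> \<Lambda> w" and in_b: "w \<in> {..b} \<longleftrightarrow> s \<le> \<Lambda> w"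
      and in_UNIV: "w \<in> UNIV \<longleftrightarrow> 0 \<le> \<Lambda> w" if "w \<in> supp" for w
      using le_iff[OF that a(1)] le_iff[OF that b(1)] a(2) b(2) \<Lambda>_pos[OF that] by simp_all
    have meas: "measure ?M {y \<in> space ?M. y 1 \<le> a \<and> y K \<le> b} = arrival_tail K s r"
      using emeasure_mgev[OF _ _ in_a in_b less_imp_le[OF r(1)] K] by (simp add: measure_def arrival_tail_nonneg)
    have meas_1: "measure ?M {y \<in> space ?M. y 1 \<le> a} = arrival_tail K 0 r"
      using emeasure_mgev[OF _ _ in_a in_UNIV less_imp_le[OF r(1)] K] by (simp add: measure_def arrival_tail_nonneg)
    have meas_K: "measure ?M {y \<in> space ?M. y K \<le> b} = arrival_tail K s 0"
      using emeasure_mgev[OF _ _ in_UNIV in_b order_refl K] by (simp add: measure_def arrival_tail_nonneg)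
    have "cdf (distr ?M borel (\<lambda>y. y 1)) a = u" "cdf (distr ?M borel (\<lambda>y. y K)) b = v"
      using K meas_1 meas_K r s by (simp_all add: cdf arrival_tail_def)
    then have D: "?D u v = arrival_tail K s r"
      using joint[of a b] meas by simp
    have "K = Suc (K - 1)" using assms(1) by simp
    then show ?thesis
      using arrival_tail_dependence_le[of r s "K - 1"] r s unfolding D by simp
  qed
  with Q show ?thesis by (rule that)
qed

theorem proposition2p5:
  fixes \<mu> \<sigma> \<xi> :: real and C :: "nat \<Rightarrow> (nat \<Rightarrow> real) \<Rightarrow> real"
  assumes "\<sigma> > 0"
    and "\<And>K. K \<ge> 2 \<Longrightarrow> is_copula_of K (C K) (mgev K \<mu> \<sigma> \<xi>)"
  shows "(\<lambda>K. spearman_rho (first_last_margin K (C K))) \<longlonglongrightarrow> 0 \<and>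
         (\<lambda>K. kendall_tau (first_last_margin K (C K))) \<longlonglongrightarrow> 0"
proof -
  interpret mgev_params \<mu> \<sigma> \<xi> by standard fact
  have bounds: "\<bar>spearman_rho (first_last_margin K (C K))\<bar> \<le> 12 * poisson_peak (K - 1) \<and>
      \<bar>kendall_tau (first_last_margin K (C K))\<bar> \<le> 8 * poisson_peak (K - 1)" if K: "K \<ge> 2" for K
  proof -
    obtain Q where "bivariate_copula Q (first_last_margin K (C K))"
      and "\<And>u v. u \<in> {0..1} \<Longrightarrow> v \<in> {0..1} \<Longrightarrow>
        \<bar>first_last_margin K (C K) u v - u * v\<bar> \<le> poisson_peak (K - 1)"
      using first_last_margin_near_independence[OF K assms(2)[OF K]] by metis
    then show ?thesis
      using bivariate_copula.spearman_rho_le bivariate_copula.kendall_tau_le by blast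
  qed
  have peak: "(\<lambda>K. poisson_peak (K - 1)) \<longlonglongrightarrow> 0"
    by (rule LIMSEQ_offset[where k = 1]) (simp add: poisson_peak_tendsto_0)
  have ev: "eventually (\<lambda>K. K \<ge> 2) sequentially" by (rule eventually_ge_at_top)
  show ?thesis
  proof
    show "(\<lambda>K. spearman_rho (first_last_margin K (C K))) \<longlonglongrightarrow> 0"
      using bounds by (intro Lim_null_comparison[OF _ tendsto_mult_right_zero[OF peak, of 12]])
        (auto intro!: eventually_mono[OF ev])
    show "(\<lambda>K. kendall_tau (first_last_margin K (C K))) \<longlonglongrightarrow> 0"
      using bounds by (intro Lim_null_comparison[OF _ tendsto_mult_right_zero[OF peak, of 8]])
        (auto intro!: eventually_mono[OF ev])
  qed
qed

end
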